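(* Let $\mathcal U\subset\mathbb R$ be a bounded interval and let $\psi:\mathcal U\to\mathbb R$ be non-decreasing and $\alpha$-Hölder for some $\alpha\in(0,1]$: $|\psi(u)-\psi(v)|\le C_1|u-v|^\alpha$ for all $u,v\in\mathcal U$, for some $C_1>0$. Let $w_1,\dots,w_n\in\mathcal U$ be i.i.d. points with density $f_w$ satisfying $\inf_{u\in\mathcal U}f_w(u)\ge C_2$ for some constant $C_2>0$, and let $y_t=\psi(w_t)+\varepsilon_t$, $t=1,\dots,n$, where the $\varepsilon_t$ are sub-Gaussian with variance proxy $\sigma^2$. Let $\widehat\psi$ be the isotonic least-squares estimator based on $\{(w_t,y_t)\}_{t=1}^n$. Then for every $\kappa>0$ and $\gamma>2$ there exist $n_0=n_0(\gamma,\kappa,\alpha)\in\mathbb N$ and $C=C(C_1,\mathcal U,\sigma,\kappa,\alpha)>0$ such that $$\mathbb P\Bigl\{\sup_{u\in\mathcal U_n}|\widehat\psi(u)-\psi(u)|\le C\,\rho_n^{\alpha/(2\alpha+1)}\Bigr\}\ \ge\ 1-\frac{1}{n^{\gamma-2}},\qquad n\ge n_0,$$ where $\rho_n=\ln(n)/n$, $\delta_n=\kappa\,\rho_n^{1/(2\alpha+1)}$, and $\mathcal U_n=\{u\in\mathcal U:[u-\delta_n,u+\delta_n]\subset\mathcal U\}$. Specifically, $n_0$ is the smallest integer $n$ satisfying $\epsilon_n<1$, where $$\epsilon_n=\max\bigl(c_n/\delta_n,\sqrt{2c_n/\delta_n}\bigr)+(n\delta_n)^{-1},\qquad c_n=\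gamma\,\frac{\ln(n+2)}{n+1}.$$
   Context: The pairs $(w_t,y_t)$ are i.i.d.; conditionally on $(w_t)_t$ the errors $\varepsilon_t$ are independent, zero-mean and sub-Gaussian with variance proxy $\sigma^2$. The isotonic least-squares estimator is $\widehat\psi\in\arg\min_{g}\sum_{t=1}^n(y_t-g(w_t))^2$ over non-decreasing functions $g$ on $\mathbb R$; it is taken piecewise constant with jumps only at a subset of the $w_t$. Its values at the distinct sorted design points $u_1<\dots<u_m$ are $\widehat\psi(u_j)=\max_{r\le j}\min_{s\ge j}\widehat y_{rs}=\min_{s\ge j}\max_{r\le j}\widehat y_{rs}$, where $\widehat y_{rs}$ is the average of the $y_t$ with $u_r\le w_t\le u_s$.
   Formalization: The constant C may also depend on C_2 and γ (and formally on the underlying sample set, removable by passing to a canonical space); with n_0 depending only on γ, κ, α, a C independent of C_2 or of γ is impossible. n_0 is the smallest such integer n ≥ 2, since δ_1 = 0. *)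

theory Defs
  imports "HOL-Probability.Probability"
begin

text \<open>
  A least-squares minimiser over the non-decreasing functions is determined only at the design
  points. Between two consecutive design points the value is left free (subject to monotonicity),
  but it has to be constant there; outside the range of the design the fit is extended by its
  extreme fitted values.
\<close>

definition isotonic_lse :: "nat \<Rightarrow> (nat \<Rightarrow> real) \<Rightarrow> (nat \<Rightarrow> real) \<Rightarrow> (real \<Rightarrow> real) \<Rightarrow> bool" where
  "isotonic_lse n w y g \<longleftrightarrow>
     is_arg_min (\<lambda>h. \<Sum>t=1..n. (y t - h (w t))\<^sup>2) mono g \<and>
     (\<forall>u v. u \<le> v \<and> {u..v} \<inter> w ` {1..n} = {} \<longrightarrow> g u = g v) \<and>
     (\<forall>u \<le> Min (w ` {1..n}). g u = g (Min (w ` {1..n}))) \<and>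
     (\<forall>u \<ge> Max (w ` {1..n}). g u = g (Max (w ` {1..n})))"

definition iid_on :: "'a measure \<Rightarrow> 'i set \<Rightarrow> ('i \<Rightarrow> 'a \<Rightarrow> 'b::topological_space) \<Rightarrow> bool" where
  "iid_on M I X \<longleftrightarrow>
     prob_space.indep_vars M (\<lambda>_. borel) X I \<and>
     (\<forall>s\<in>I. \<forall>t\<in>I. distr M borel (X s) = distr M borel (X t))"

definition gen_algebra :: "'a measure \<Rightarrow> 'i set \<Rightarrow> ('i \<Rightarrow> 'a \<Rightarrow> real) \<Rightarrow> 'a measure" where
  "gen_algebra M I X = vimage_algebra (space M) (\<lambda>\<omega>. \<lambda>t\<in>I. X t \<omega>) (\<Pi>\<^sub>M t\<in>I. borel)"

definition cond_indep_vars ::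
  "'a measure \<Rightarrow> 'a measure \<Rightarrow> 'i set \<Rightarrow> ('i \<Rightarrow> 'a \<Rightarrow> real) \<Rightarrow> bool" where
  "cond_indep_vars M F I X \<longleftrightarrow>
     (\<forall>A. (\<forall>t\<in>I. A t \<in> sets borel) \<longrightarrow>
       (AE \<omega> in M. real_cond_exp M F (\<lambda>\<omega>'. \<Prod>t\<in>I. indicat_real (A t) (X t \<omega>')) \<omega> =
                   (\<Prod>t\<in>I. real_cond_exp M F (\<lambda>\<omega>'. indicat_real (A t) (X t \<omega>')) \<omega>)))"

text \<open>
  The moment generating function is taken with the \<open>ennreal\<close>-valued conditional expectation,
  because the real-valued one of a non-integrable function is a meaningless finite number.
\<close>

definition cond_subgaussian ::
  "'a measure \<Rightarrow> 'a measure \<Rightarrow> real \<Rightarrow> ('a \<Rightarrow> real) \<Rightarrow> bool" where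
  "cond_subgaussian M F v X \<longleftrightarrow> X \<in> borel_measurable M \<and>
     (\<forall>l. AE \<omega> in M. nn_cond_exp M F (\<lambda>\<omega>'. ennreal (exp (l * X \<omega>'))) \<omega>
                      \<le> ennreal (exp (l\<^sup>2 * v / 2)))"

text \<open>
  The regression function \<open>\<psi>\<close> and the density matter only on \<open>U\<close>; their values elsewhere are
  arbitrary. Conditioning is on the whole design \<open>w 1, \<dots>, w n\<close>.
\<close>

definition regression_sample ::
  "'a measure \<Rightarrow> nat \<Rightarrow> real set \<Rightarrow> real \<Rightarrow> real \<Rightarrow> (real \<Rightarrow> real) \<Rightarrow>
    (nat \<Rightarrow> 'a \<Rightarrow> real) \<Rightarrow> (nat \<Rightarrow> 'a \<Rightarrow> real) \<Rightarrow> (nat \<Rightarrow> 'a \<Rightarrow> real) \<Rightarrow> bool" where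
  "regression_sample M n U C\<^sub>2 \<sigma> \<psi> w e y \<longleftrightarrow>
     prob_space M \<and>
     iid_on M {1..n} (\<lambda>t \<omega>. (w t \<omega>, y t \<omega>)) \<and>
     (\<forall>t\<in>{1..n}. \<forall>\<omega>\<in>space M. w t \<omega> \<in> U) \<and>
     (\<exists>f. (\<forall>t\<in>{1..n}. distributed M lborel (w t) (\<lambda>u. ennreal (f u))) \<and> (\<forall>u\<in>U. C\<^sub>2 \<le> f u)) \<and>
     (\<forall>t\<in>{1..n}. \<forall>\<omega>\<in>space M. y t \<omega> = \<psi> (w t \<omega>) + e t \<omega>) \<and>
     cond_indep_vars M (gen_algebra M {1..n} w) {1..n} e \<and>
     (\<forall>t\<in>{1..n}. integrable M (e t) \<and>
        (AE \<omega> in M. real_cond_exp M (gen_algebra M {1..n} w) (e t) \<omega> = 0) \<and>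
        cond_subgaussian M (gen_algebra M {1..n} w) (\<sigma>\<^sup>2) (e t))"

definition rho_seq :: "nat \<Rightarrow> real" where
  "rho_seq n = ln (real n) / real n"

definition delta_seq :: "real \<Rightarrow> real \<Rightarrow> nat \<Rightarrow> real" where
  "delta_seq \<kappa> \<alpha> n = \<kappa> * rho_seq n powr (1 / (2 * \<alpha> + 1))"

definition c_seq :: "real \<Rightarrow> nat \<Rightarrow> real" where
  "c_seq \<gamma> n = \<gamma> * ln (real n + 2) / (real n + 1)"

text \<open>Only meaningful for \<open>n \<ge> 2\<close>: \<open>delta_seq \<kappa> \<alpha> n = 0\<close> for \<open>n \<le> 1\<close>, and then division by
  zero would give the value \<open>0\<close> instead of \<open>\<infinity>\<close>.\<close>

definition eps_seq :: "real \<Rightarrow> real \<Rightarrow> real \<Rightarrow> nat \<Rightarrow> real" where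
  "eps_seq \<gamma> \<kappa> \<alpha> n =
     max (c_seq \<gamma> n / delta_seq \<kappa> \<alpha> n) (sqrt (2 * c_seq \<gamma> n / delta_seq \<kappa> \<alpha> n))
       + 1 / (real n * delta_seq \<kappa> \<alpha> n)"

text \<open>This set may be empty, so suprema over it are taken in \<open>ereal\<close>, where they are then \<open>-\<infinity>\<close>.\<close>

definition inner_domain :: "real set \<Rightarrow> real \<Rightarrow> real set" where
  "inner_domain U \<delta> = {u \<in> U. {u - \<delta>..u + \<delta>} \<subseteq> U}"

end

theory Submission
  imports Defs "HOL-Real_Asymp.Real_Asymp"
begin

text \<open>
  Lowering the fit \<open>g\<close> slightly on the block of design points \<open>w t \<le> b\<close> with \<open>g (w t) \<ge> g u\<close> keeps
  it monotone, so minimality makes \<open>g u\<close> at most the average of \<open>y\<close> over this block, which contains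
  every design point of \<open>[u, b]\<close>. Hence \<open>g u \<le> \<psi> b + z / sqrt m\<close> as soon as \<open>[u, b]\<close> contains \<open>m\<close>
  design points and every sum of errors over \<open>k\<close> consecutive design points is at most \<open>z * sqrt k\<close>;
  reflection gives the lower bound. Conditionally on the design the latter holds for all of the at
  most \<open>n\<^sup>2\<close> blocks with \<open>z\<close> of order \<open>sqrt (ln n)\<close>, and a Chernoff bound on a grid of cells of
  length \<open>\<delta>\<^sub>n / 2\<close> gives \<open>m\<close> of order \<open>n * \<delta>\<^sub>n\<close> for \<open>b = u + \<delta>\<^sub>n\<close>.

  The Chernoff bound is strong enough only for \<open>n\<close> beyond a threshold that depends on \<open>C\<^sub>2\<close>. For the
  finitely many smaller \<open>n\<close> the event on the errors alone bounds the estimation error by the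
  oscillation of \<open>\<psi>\<close> plus \<open>z\<close>, which the constant \<open>C\<close> absorbs.
\<close>

section \<open>Block averages of the isotonic fit\<close>

text \<open>The clipped value \<open>min (max (s - c) 0) d\<close> is nondecreasing and 1-Lipschitz
  in \<open>s\<close>, so subtracting a fraction \<open>\<theta>\<close> of it preserves the order
  of the values of \<open>g\<close>. Across \<open>b\<close> nothing can break, because values are
  lowered only on the left.\<close>

lemma mono_clip_shift:
  fixes g :: "real \<Rightarrow> real"
  assumes g: "mono g" and \<theta>: "0 \<le> \<theta>" "\<theta> \<le> 1" and "0 \<le> d"
  shows "mono (\<lambda>x. if x \<le> b then g x - \<theta> * min (max (g x - c) 0) d else g x)"
proof (rule monoI)
  fix x x' :: real
  assume "x \<le> x'"
  then have gx: "g x \<le> g x'"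
    using g by (simp add: monoD)
  let ?k = "\<lambda>s. min (max (s - c) 0) d"
  have "\<theta> * (?k (g x') - ?k (g x)) \<le> ?k (g x') - ?k (g x)"
    using \<theta> gx by (intro mult_left_le_one_le) auto
  also have "\<dots> \<le> g x' - g x"
    using gx by auto
  finally have 1: "g x - \<theta> * ?k (g x) \<le> g x' - \<theta> * ?k (g x')"
    by (simp add: algebra_simps)
  have 2: "g x - \<theta> * ?k (g x) \<le> g x'"
    using \<theta> \<open>0 \<le> d\<close> gx by (smt (verit) mult_nonneg_nonneg)
  show "(if x \<le> b then g x - \<theta> * ?k (g x) else g x) \<le>
        (if x' \<le> b then g x' - \<theta> * ?k (g x') else g x')"
    using 1 2 gx \<open>x \<le> x'\<close> by auto
qed

text \<open>Were the sum \<open>S\<close> negative, lowering the fit on the block by a small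
  \<open>\<eta>\<close> would change the objective by
  \<open>\<eta> * (2 * S + card B * \<eta>) < 0\<close>, against minimality.\<close>

lemma lse_block_sum_nonneg:
  fixes w y :: "'i \<Rightarrow> real" and g :: "real \<Rightarrow> real"
  assumes "finite I" and lse: "is_arg_min (\<lambda>h. \<Sum>t\<in>I. (y t - h (w t))\<^sup>2) mono g"
  shows "0 \<le> (\<Sum>t | t \<in> I \<and> w t \<le> b \<and> p \<le> g (w t). y t - g (w t))"
proof (rule ccontr)
  define B where "B = {t \<in> I. w t \<le> b \<and> p \<le> g (w t)}"
  define S where "S = (\<Sum>t\<in>B. y t - g (w t))"
  assume "\<not> ?thesis"
  then have S: "S < 0"
    by (simp add: S_def B_def)
  \<comment> \<open>The inserted \<open>p - 1\<close> keeps the set nonempty when no fitted value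
    lies below \<open>p\<close>.\<close>
  define c where "c = Max (insert (p - 1) {v \<in> (\<lambda>t. g (w t)) ` I. v < p})"
  have fin: "finite (insert (p - 1) {v \<in> (\<lambda>t. g (w t)) ` I. v < p})"
    using \<open>finite I\<close> by simp
  have "c < p"
    using Max_in[OF fin] by (auto simp: c_def)
  \<comment> \<open>No fitted value lies strictly between \<open>c\<close> and \<open>p\<close>, so at the design points the clipped
    shift below is an exact shift by \<open>\<eta>\<close> on \<open>B\<close>.\<close>
  have gap: "g (w t) \<le> c" if "t \<in> I" "g (w t) < p" for t
    using that fin by (auto simp: c_def intro!: Max_ge)
  \<comment> \<open>The first bound keeps the coefficient \<open>\<eta> / (p - c)\<close> at most 1,
    for the monotonicity of \<open>h\<close>; the second gives
    \<open>card B * \<eta> \<le> - S\<close>, its \<open>+ 1\<close> keeping the denominator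
    positive.\<close>
  define \<eta> where "\<eta> = min (p - c) (- S / (card B + 1))"
  have "0 < \<eta>"
    using \<open>c < p\<close> S by (simp add: \<eta>_def divide_neg_pos)
  define h where "h = (\<lambda>x. if x \<le> b then g x - \<eta> / (p - c) * min (max (g x - c) 0) (p - c) else g x)"
  have "\<eta> / (p - c) \<le> 1"
    using \<open>c < p\<close> by (simp add: \<eta>_def)
  then have "mono h"
    unfolding h_def using lse \<open>0 < \<eta>\<close> \<open>c < p\<close>
    by (intro mono_clip_shift) (auto simp: is_arg_min_def)
  have hB: "h (w t) = (if t \<in> B then g (w t) - \<eta> else g (w t))" if "t \<in> I" for t
    using gap[OF that] \<open>c < p\<close> that by (auto simp: h_def B_def)
  have "(\<Sum>t\<in>I. (y t - g (w t))\<^sup>2) \<le> (\<Sum>t\<in>I. (y t - h (w t))\<^sup>2)"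
    using lse \<open>mono h\<close> by (auto simp: is_arg_min_def not_less)
  also have "\<dots> = (\<Sum>t\<in>I. (y t - g (w t))\<^sup>2 + (if t \<in> B then 2 * \<eta> * (y t - g (w t)) + \<eta>\<^sup>2 else 0))"
    by (intro sum.cong) (auto simp: hB power2_eq_square algebra_simps)
  also have "\<dots> = (\<Sum>t\<in>I. (y t - g (w t))\<^sup>2) + (\<Sum>t\<in>B. 2 * \<eta> * (y t - g (w t)) + \<eta>\<^sup>2)"
    using \<open>finite I\<close> by (simp add: sum.distrib sum.If_cases B_def Int_def conj_commute)
  also have "(\<Sum>t\<in>B. 2 * \<eta> * (y t - g (w t)) + \<eta>\<^sup>2) = \<eta> * (2 * S + card B * \<eta>)"
    by (simp only: sum.distrib sum_distrib_left[symmetric] S_def[symmetric])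
       (simp add: power2_eq_square algebra_simps)
  finally have "0 \<le> 2 * S + card B * \<eta>"
    using \<open>0 < \<eta>\<close> by (simp add: zero_le_mult_iff)
  moreover have "card B * \<eta> \<le> (card B + 1) * (- S / (card B + 1))"
    using \<open>0 < \<eta>\<close> by (intro mult_mono) (auto simp: \<eta>_def)
  ultimately show False
    using S by simp
qed

text \<open>The ends are design points given by their indices, so each design has at most
  \<open>n\<^sup>2\<close> of these sets; tied design points always lie in a window
  together.\<close>

definition window :: "nat \<Rightarrow> (nat \<Rightarrow> real) \<Rightarrow> nat \<Rightarrow> nat \<Rightarrow> nat set" where
  "window n w r s = {t \<in> {1..n}. w r \<le> w t \<and> w t \<le> w s}"

text \<open>The block with nonnegative residual sum is a window of at least \<open>m\<close> points.
  On it \<open>\<psi> (w t) \<le> \<psi> b\<close> and \<open>g u \<le> g (w t)\<close>, so after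
  division by its size there remain \<open>\<psi> b - g u\<close> and a noise average of at most
  \<open>x / sqrt m\<close>.\<close>

lemma lse_le:
  fixes w y e :: "nat \<Rightarrow> real" and g \<psi> :: "real \<Rightarrow> real" and m :: real
  assumes lse: "is_arg_min (\<lambda>h. \<Sum>t=1..n. (y t - h (w t))\<^sup>2) mono g"
    and y: "\<And>t. t \<in> {1..n} \<Longrightarrow> y t = \<psi> (w t) + e t"
    and \<psi>: "mono_on U \<psi>" and w: "w ` {1..n} \<subseteq> U" and "b \<in> U"
    and noise: "\<And>r s. r \<in> {1..n} \<Longrightarrow> s \<in> {1..n} \<Longrightarrow>
      (\<Sum>t\<in>window n w r s. e t) \<le> x * sqrt (card (window n w r s))"
    and m: "0 < m" "m \<le> card {t \<in> {1..n}. u \<le> w t \<and> w t \<le> b}" and "0 \<le> x"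
  shows "g u \<le> \<psi> b + x / sqrt m"
proof -
  define B where "B = {t \<in> {1..n}. w t \<le> b \<and> g u \<le> g (w t)}"
  have "mono g"
    using lse by (simp add: is_arg_min_def)
  have fin: "finite B"
    by (simp add: B_def)
  have "{t \<in> {1..n}. u \<le> w t \<and> w t \<le> b} \<subseteq> B"
    using \<open>mono g\<close> by (auto simp: B_def monoD)
  then have "card {t \<in> {1..n}. u \<le> w t \<and> w t \<le> b} \<le> card B"
    using fin by (rule card_mono[rotated])
  then have mB: "m \<le> card B"
    using m by linarith
  then have "0 < card B"
    using m by linarith
  then have "B \<noteq> {}"
    by auto
  obtain r where r: "r \<in> B" "\<And>t. t \<in> B \<Longrightarrow> w r \<le> w t"
    using fin \<open>B \<noteq> {}\<close> by (metis (no_types, lifting) arg_min_if_finite(1) arg_min_least)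
  obtain s where s: "s \<in> B" "\<And>t. t \<in> B \<Longrightarrow> w t \<le> w s"
    using obtains_MAX[OF fin \<open>B \<noteq> {}\<close>, of w] fin by (metis Max_ge finite_imageI image_eqI)
  \<comment> \<open>A design point between \<open>w r\<close> and \<open>w s\<close> is at most
    \<open>b\<close>, and its fitted value is at least \<open>g (w r)\<close>, hence at least
    \<open>g u\<close>.\<close>
  have B: "B = window n w r s"
    using r s \<open>mono g\<close> by (fastforce simp: B_def window_def dest: monoD)
  have "0 \<le> (\<Sum>t\<in>B. y t - g (w t))"
    using lse_block_sum_nonneg[OF _ lse, of b "g u"] by (simp add: B_def)
  also have "\<dots> \<le> (\<Sum>t\<in>B. \<psi> b - g u + e t)"
    using y w \<open>b \<in> U\<close> mono_onD[OF \<psi>] by (intro sum_mono) (fastforce simp: B_def)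
  also have "\<dots> \<le> card B * (\<psi> b - g u) + x * sqrt (card B)"
    using noise[of r s] r s by (simp add: sum.distrib B[symmetric]) (simp add: B_def)
  also have "\<dots> = card B * (\<psi> b - g u + x / sqrt (card B))"
    using \<open>0 < card B\<close> by (simp add: distrib_left real_div_sqrt field_simps)
  finally have "g u \<le> \<psi> b + x / sqrt (card B)"
    using \<open>0 < card B\<close> by (simp add: zero_le_mult_iff)
  also have "x / sqrt (card B) \<le> x / sqrt m"
    using mB m \<open>0 \<le> x\<close> by (intro divide_left_mono) auto
  finally show ?thesis by simp
qed

text \<open>Reflection turns \<open>g\<close> into \<open>\<lambda>x. - g (- x)\<close>, again a
  monotone minimiser for the data \<open>- w\<close> and \<open>- y\<close>, and exchanges the two
  ends of every window, so \<open>lse_le\<close> applies.\<close>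

lemma lse_ge:
  fixes w y e :: "nat \<Rightarrow> real" and g \<psi> :: "real \<Rightarrow> real" and m :: real
  assumes lse: "is_arg_min (\<lambda>h. \<Sum>t=1..n. (y t - h (w t))\<^sup>2) mono g"
    and y: "\<And>t. t \<in> {1..n} \<Longrightarrow> y t = \<psi> (w t) + e t"
    and \<psi>: "mono_on U \<psi>" and w: "w ` {1..n} \<subseteq> U" and "a \<in> U"
    and noise: "\<And>r s. r \<in> {1..n} \<Longrightarrow> s \<in> {1..n} \<Longrightarrow>
      - (x * sqrt (card (window n w r s))) \<le> (\<Sum>t\<in>window n w r s. e t)"
    and m: "0 < m" "m \<le> card {t \<in> {1..n}. a \<le> w t \<and> w t \<le> u}" and "0 \<le> x"
  shows "\<psi> a - x / sqrt m \<le> g u"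
proof -
  have win: "window n (\<lambda>t. - w t) r s = window n w s r" for r s
    by (auto simp: window_def)
  have mono_refl: "mono (\<lambda>x. - h (- x))" if "mono h" for h :: "real \<Rightarrow> real"
    using that by (simp add: mono_def)
  have obj: "(\<Sum>t=1..n. (- y t - h (- w t))\<^sup>2) = (\<Sum>t=1..n. (y t - - h (- w t))\<^sup>2)" for h
    by (intro sum.cong) (auto simp: power2_eq_square algebra_simps)
  have "is_arg_min (\<lambda>h. \<Sum>t=1..n. (- y t - h (- w t))\<^sup>2) mono (\<lambda>x. - g (- x))"
    using lse mono_refl unfolding is_arg_min_def obj by (auto dest: mono_refl)
  moreover have "mono_on (uminus ` U) (\<lambda>x. - \<psi> (- x))"
    using mono_onD[OF \<psi>] by (auto intro!: mono_onI)
  moreover have "{t \<in> {1..n}. - u \<le> - w t \<and> - w t \<le> - a} = {t \<in> {1..n}. a \<le> w t \<and> w t \<le> u}"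
    by auto
  moreover have "(\<Sum>t\<in>window n w s r. - e t) \<le> x * sqrt (card (window n w s r))"
    if "r \<in> {1..n}" "s \<in> {1..n}" for r s
    using noise[OF that(2,1)] by (simp add: sum_negf)
  ultimately have "- g (- (- u)) \<le> - \<psi> (- (- a)) + x / sqrt m"
    using y w \<open>a \<in> U\<close> m \<open>0 \<le> x\<close>
    by (intro lse_le[where n = n and g = "\<lambda>x. - g (- x)" and u = "- u" and b = "- a"
          and y = "\<lambda>t. - y t" and w = "\<lambda>t. - w t" and e = "\<lambda>t. - e t"
          and \<psi> = "\<lambda>x. - \<psi> (- x)" and U = "uminus ` U"])
       (auto simp: win)
  then show ?thesis by simp
qed

text \<open>A single design point suffices (\<open>m = 1\<close>): the largest one bounds the fit
  from above, the smallest one from below. This covers sample sizes for which short intervals may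
  contain no design point.\<close>

lemma isotonic_lse_crude_bound:
  fixes w y e :: "nat \<Rightarrow> real" and g \<psi> :: "real \<Rightarrow> real" and L z :: real
  assumes lse: "isotonic_lse n w y g" and "1 \<le> n"
    and y: "\<And>t. t \<in> {1..n} \<Longrightarrow> y t = \<psi> (w t) + e t"
    and \<psi>: "mono_on U \<psi>" and w: "w ` {1..n} \<subseteq> U"
    and noise: "\<And>r s. r \<in> {1..n} \<Longrightarrow> s \<in> {1..n} \<Longrightarrow>
      \<bar>\<Sum>t\<in>window n w r s. e t\<bar> \<le> z * sqrt (card (window n w r s))"
    and "0 \<le> z" and L: "\<And>u v. u \<in> U \<Longrightarrow> v \<in> U \<Longrightarrow> \<bar>\<psi> u - \<psi> v\<bar> \<le> L"
    and "u \<in> U"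
  shows "\<bar>g u - \<psi> u\<bar> \<le> L + z"
proof -
  have am: "is_arg_min (\<lambda>h. \<Sum>t=1..n. (y t - h (w t))\<^sup>2) mono g"
    using lse unfolding isotonic_lse_def by blast
  have fin: "finite (w ` {1..n})" and ne: "w ` {1..n} \<noteq> {}"
    using \<open>1 \<le> n\<close> by auto
  obtain i where i: "i \<in> {1..n}" "w i = Max (w ` {1..n})"
    using Max_in[OF fin ne] by auto
  obtain j where j: "j \<in> {1..n}" "w j = Min (w ` {1..n})"
    using Min_in[OF fin ne] by auto
  have le_i: "w t \<le> w i" and ge_j: "w j \<le> w t" if "t \<in> {1..n}" for t
    unfolding i(2) j(2) using that fin by simp_all
  have wU: "w i \<in> U" "w j \<in> U"
    using i(1) j(1) w by auto
  have nonempty_card: "1 \<le> real (card {t \<in> {1..n}. a \<le> w t \<and> w t \<le> b})"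
    if "t \<in> {1..n}" "a \<le> w t" "w t \<le> b" for t a b
  proof -
    have "card {t \<in> {1..n}. a \<le> w t \<and> w t \<le> b} > 0"
      using that by (subst card_gt_0_iff) auto
    then show ?thesis by simp
  qed
  \<comment> \<open>Beyond the last design point the interval from \<open>u\<close> to
    \<open>w i\<close> is empty, so the constant extension of the fit is used to move
    \<open>u\<close> back to \<open>w i\<close>.\<close>
  have "g u = g (w i)" if "w i \<le> u"
    using lse that unfolding isotonic_lse_def i(2) by blast
  then have "g u = g (min u (w i))"
    by (simp add: min_def)
  also have "\<dots> \<le> \<psi> (w i) + z / sqrt 1"
    using noise by (intro lse_le[OF am y \<psi> w wU(1)] nonempty_card[OF i(1)])
      (auto simp: abs_le_iff \<open>0 \<le> z\<close>)
  finally have upper: "g u \<le> \<psi> (w i) + z" by simp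
  have "g u = g (w j)" if "u \<le> w j"
    using lse that unfolding isotonic_lse_def j(2) by blast
  then have eq: "g (max u (w j)) = g u"
    by (simp add: max_def)
  have "\<psi> (w j) - z / sqrt 1 \<le> g (max u (w j))"
    using noise by (intro lse_ge[OF am y \<psi> w wU(2)] nonempty_card[OF j(1)])
      (auto simp: abs_le_iff minus_le_iff \<open>0 \<le> z\<close>)
  then have "\<psi> (w j) - z \<le> g u"
    by (simp add: eq)
  with upper show ?thesis
    using L[OF wU(1) \<open>u \<in> U\<close>] L[OF wU(2) \<open>u \<in> U\<close>] by linarith
qed

text \<open>The two terms are bias and noise: the fit at \<open>u\<close> is compared with
  \<open>\<psi>\<close> at distance \<open>\<delta>\<close> on either side. Membership in
  \<open>inner_domain\<close> keeps both intervals inside \<open>U\<close>, where the point counts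
  are available.\<close>

lemma lse_local_bound:
  fixes w y e :: "nat \<Rightarrow> real" and g \<psi> :: "real \<Rightarrow> real" and m z \<delta> :: real
  assumes lse: "is_arg_min (\<lambda>h. \<Sum>t=1..n. (y t - h (w t))\<^sup>2) mono g"
    and y: "\<And>t. t \<in> {1..n} \<Longrightarrow> y t = \<psi> (w t) + e t"
    and \<psi>: "mono_on U \<psi>" and w: "w ` {1..n} \<subseteq> U"
    and noise: "\<And>r s. r \<in> {1..n} \<Longrightarrow> s \<in> {1..n} \<Longrightarrow>
      \<bar>\<Sum>t\<in>window n w r s. e t\<bar> \<le> z * sqrt (card (window n w r s))"
    and "0 \<le> z" "0 < m" "0 \<le> \<delta>"
    and count: "\<And>a. {a..a + \<delta>} \<subseteq> U \<Longrightarrow> m \<le> card {t \<in> {1..n}. a \<le> w t \<and> w t \<le> a + \<delta>}"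
    and holder: "\<And>u v. u \<in> U \<Longrightarrow> v \<in> U \<Longrightarrow> \<bar>\<psi> u - \<psi> v\<bar> \<le> C * \<bar>u - v\<bar> powr \<alpha>"
    and u: "u \<in> inner_domain U \<delta>"
  shows "\<bar>g u - \<psi> u\<bar> \<le> C * \<delta> powr \<alpha> + z / sqrt m"
proof -
  have "u \<in> U" and sub: "{u - \<delta>..u + \<delta>} \<subseteq> U"
    using u by (auto simp: inner_domain_def)
  then have U: "u - \<delta> \<in> U" "u + \<delta> \<in> U"
    using \<open>0 \<le> \<delta>\<close> by (auto simp: subset_iff)
  have "{u..u + \<delta>} \<subseteq> U" "{u - \<delta>..(u - \<delta>) + \<delta>} \<subseteq> U"
    using sub \<open>0 \<le> \<delta>\<close> by (auto simp: subset_iff)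
  note counts = this[THEN count]
  have "g u \<le> \<psi> (u + \<delta>) + z / sqrt m"
    using noise counts(1) \<open>0 < m\<close> \<open>0 \<le> z\<close>
    by (intro lse_le[OF lse y \<psi> w U(2)]) (auto simp: abs_le_iff)
  moreover have "\<psi> (u - \<delta>) - z / sqrt m \<le> g u"
    using noise counts(2) \<open>0 < m\<close> \<open>0 \<le> z\<close>
    by (intro lse_ge[OF lse y \<psi> w U(1)]) (auto simp: abs_le_iff minus_le_iff)
  moreover have "\<bar>\<psi> (u + \<delta>) - \<psi> u\<bar> \<le> C * \<delta> powr \<alpha>" "\<bar>\<psi> (u - \<delta>) - \<psi> u\<bar> \<le> C * \<delta> powr \<alpha>"
    using holder[OF U(2) \<open>u \<in> U\<close>] holder[OF U(1) \<open>u \<in> U\<close>] \<open>0 \<le> \<delta>\<close> by auto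
  ultimately show ?thesis by linarith
qed

section \<open>Conditional independence and sub-Gaussian sums\<close>

context sigma_finite_subalgebra
begin

lemma nn_cond_exp_cmult:
  assumes [measurable]: "f \<in> borel_measurable M"
  shows "AE x in M. nn_cond_exp M F (\<lambda>x. c * f x) x = c * nn_cond_exp M F f x"
  using nn_cond_exp_prod[of "\<lambda>_. c" f] by auto

text \<open>Conditional monotone convergence: over each set of \<open>F\<close> the supremum passes
  through the integral both for \<open>f i\<close> and for the conditional expectations, which
  increase almost everywhere.\<close>

lemma nn_cond_exp_SUP:
  fixes f :: "nat \<Rightarrow> 'a \<Rightarrow> ennreal"
  assumes [measurable]: "\<And>i. f i \<in> borel_measurable M" and "incseq f"
  shows "AE x in M. nn_cond_exp M F (\<lambda>x. SUP i. f i x) x = (SUP i. nn_cond_exp M F (f i) x)"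
proof -
  have mono: "AE x in M. \<forall>i. nn_cond_exp M F (f i) x \<le> nn_cond_exp M F (f (Suc i)) x"
    unfolding AE_all_countable
    using \<open>incseq f\<close> by (intro allI nn_cond_exp_mono) (auto simp: incseq_Suc_iff le_fun_def)
  have "AE x in M. (SUP i. nn_cond_exp M F (f i) x) = nn_cond_exp M F (\<lambda>x. SUP i. f i x) x"
  proof (rule nn_cond_exp_charact)
    fix A assume A [measurable]: "A \<in> sets F"
    then have [measurable]: "A \<in> sets M"
      using subalg by (auto simp: subalgebra_def)
    have "(\<integral>\<^sup>+x\<in>A. (SUP i. f i x) \<partial>M) = (\<integral>\<^sup>+x. (SUP i. indicator A x * f i x) \<partial>M)"
      by (simp add: SUP_mult_left_ennreal mult.commute)
    also have "\<dots> = (SUP i. \<integral>\<^sup>+x. indicator A x * f i x \<partial>M)"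
      using \<open>incseq f\<close> by (intro nn_integral_monotone_convergence_SUP)
        (auto simp: incseq_def le_fun_def intro!: mult_left_mono)
    also have "\<dots> = (SUP i. \<integral>\<^sup>+x. indicator A x * nn_cond_exp M F (f i) x \<partial>M)"
      by (simp add: nn_cond_exp_intg)
    also have "\<dots> = (\<integral>\<^sup>+x. (SUP i. indicator A x * nn_cond_exp M F (f i) x) \<partial>M)"
      using mono by (intro nn_integral_monotone_convergence_SUP_AE[symmetric])
        (auto intro!: mult_left_mono)
    also have "\<dots> = (\<integral>\<^sup>+x\<in>A. (SUP i. nn_cond_exp M F (f i) x) \<partial>M)"
      by (simp add: SUP_mult_left_ennreal mult.commute)
    finally show "(\<integral>\<^sup>+x\<in>A. (SUP i. f i x) \<partial>M) = (\<integral>\<^sup>+x\<in>A. (SUP i. nn_cond_exp M F (f i) x) \<partial>M)" .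
  qed measurable
  then show ?thesis by auto
qed

text \<open>Used to pass, one coordinate at a time, from indicators to exponentials in the definition of
  conditional independence.\<close>

lemma nn_cond_exp_mult_indicatorI:
  fixes h :: "'b \<Rightarrow> ennreal"
  assumes X [measurable]: "X \<in> measurable M N" and R [measurable]: "R \<in> borel_measurable M"
    and ind: "\<And>A. A \<in> sets N \<Longrightarrow> AE x in M. nn_cond_exp M F (\<lambda>x. indicator A (X x) * R x) x =
      nn_cond_exp M F (\<lambda>x. indicator A (X x)) x * Q x"
    and h: "h \<in> borel_measurable N"
  shows "AE x in M. nn_cond_exp M F (\<lambda>x. h (X x) * R x) x =
    nn_cond_exp M F (\<lambda>x. h (X x)) x * Q x"
  using h
proof (induction h rule: borel_measurable_induct)
  case (cong f g)
  note [measurable] = cong(1,2)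
  have eq: "f (X x) = g (X x)" if "x \<in> space M" for x
    using cong(3) measurable_space[OF X that] by simp
  have "AE x in M. nn_cond_exp M F (\<lambda>x. f (X x) * R x) x = nn_cond_exp M F (\<lambda>x. g (X x) * R x) x"
    by (intro nn_cond_exp_cong) (auto simp: eq)
  moreover have "AE x in M. nn_cond_exp M F (\<lambda>x. f (X x)) x = nn_cond_exp M F (\<lambda>x. g (X x)) x"
    by (intro nn_cond_exp_cong) (auto simp: eq)
  ultimately show ?case
    using cong(4) by eventually_elim simp
next
  case (set A)
  then show ?case by (rule ind)
next
  case (mult u c)
  note [measurable] = mult(2)
  have "AE x in M. nn_cond_exp M F (\<lambda>x. c * (u (X x) * R x)) x = c * nn_cond_exp M F (\<lambda>x. u (X x) * R x) x"
    by (intro nn_cond_exp_cmult) measurable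
  moreover have "AE x in M. nn_cond_exp M F (\<lambda>x. c * u (X x)) x = c * nn_cond_exp M F (\<lambda>x. u (X x)) x"
    by (intro nn_cond_exp_cmult) measurable
  ultimately show ?case
    using mult(4) by eventually_elim (simp add: mult.assoc)
next
  case (add u v)
  note [measurable] = add(1,3)
  have "AE x in M. nn_cond_exp M F (\<lambda>x. v (X x) * R x) x + nn_cond_exp M F (\<lambda>x. u (X x) * R x) x
      = nn_cond_exp M F (\<lambda>x. v (X x) * R x + u (X x) * R x) x"
    by (intro nn_cond_exp_sum) measurable
  moreover have "AE x in M. nn_cond_exp M F (\<lambda>x. v (X x)) x + nn_cond_exp M F (\<lambda>x. u (X x)) x
      = nn_cond_exp M F (\<lambda>x. v (X x) + u (X x)) x"
    by (intro nn_cond_exp_sum) measurable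
  ultimately show ?case
    using add(6,7) by eventually_elim (simp add: distrib_right, metis distrib_right)
next
  case (seq U)
  note [measurable] = seq(1)
  have inc: "incseq (\<lambda>i x. U i (X x))"
    using seq(3) by (auto simp: incseq_def le_fun_def)
  then have "incseq (\<lambda>i x. U i (X x) * R x)"
    by (auto simp: incseq_def le_fun_def intro!: mult_right_mono)
  then have "AE x in M. nn_cond_exp M F (\<lambda>x. SUP i. U i (X x) * R x) x = (SUP i. nn_cond_exp M F (\<lambda>x. U i (X x) * R x) x)"
    by (intro nn_cond_exp_SUP) auto
  moreover have "AE x in M. nn_cond_exp M F (\<lambda>x. SUP i. U i (X x)) x = (SUP i. nn_cond_exp M F (\<lambda>x. U i (X x)) x)"
    using inc by (intro nn_cond_exp_SUP) auto
  moreover have "AE x in M. \<forall>i. nn_cond_exp M F (\<lambda>x. U i (X x) * R x) x = nn_cond_exp M F (\<lambda>x. U i (X x)) x * Q x"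
    using seq(5) by (simp add: AE_all_countable)
  ultimately show ?case
    by eventually_elim (simp add: SUP_mult_right_ennreal image_comp)
qed

end

context finite_measure_subalgebra
begin

text \<open>Links the real-valued conditional expectations of \<open>cond_indep_vars\<close> to the
  \<open>ennreal\<close>-valued ones: the bound by 1 makes the latter finite, so conversion to a
  real loses nothing, and the negative part vanishes.\<close>

lemma nn_cond_exp_eq_real_cond_exp:
  fixes f :: "'a \<Rightarrow> real"
  assumes [measurable]: "f \<in> borel_measurable M" and f: "\<And>x. 0 \<le> f x" "\<And>x. f x \<le> 1"
  shows "AE x in M. nn_cond_exp M F (\<lambda>x. ennreal (f x)) x = ennreal (real_cond_exp M F f x)"
proof -
  have neg: "(\<lambda>x. ennreal (- f x)) = (\<lambda>_. 0)"
    using f by (auto simp: ennreal_neg)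
  have "AE x in M. nn_cond_exp M F (\<lambda>x. ennreal (f x)) x \<le> nn_cond_exp M F (\<lambda>_. 1) x"
    using f by (intro nn_cond_exp_mono) auto
  moreover have "AE x in M. 1 = nn_cond_exp M F (\<lambda>_. 1) x"
    by (intro nn_cond_exp_F_meas) auto
  moreover have "AE x in M. 0 = nn_cond_exp M F (\<lambda>_. 0) x"
    by (intro nn_cond_exp_F_meas) auto
  ultimately show ?thesis
    unfolding real_cond_exp_def neg
    by eventually_elim (auto intro!: ennreal_enn2real[symmetric] elim!: le_less_trans)
qed

text \<open>Induction on the set \<open>J\<close> of coordinates that carry arbitrary functions, the
  others still carrying indicators. For empty \<open>J\<close> this is the definition of conditional
  independence; the claim is the case \<open>J = I\<close>.\<close>

lemma nn_cond_exp_prod_cond_indep: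
  fixes f :: "'i \<Rightarrow> real \<Rightarrow> ennreal"
  assumes "finite I" and X [measurable]: "\<And>t. t \<in> I \<Longrightarrow> X t \<in> borel_measurable M"
    and indep: "cond_indep_vars M F I X"
    and "\<And>t. t \<in> I \<Longrightarrow> f t \<in> borel_measurable borel"
  shows "AE x in M. nn_cond_exp M F (\<lambda>x. \<Prod>t\<in>I. f t (X t x)) x =
    (\<Prod>t\<in>I. nn_cond_exp M F (\<lambda>x. f t (X t x)) x)"
proof -
  have "AE x in M. nn_cond_exp M F (\<lambda>x. \<Prod>t\<in>I. f t (X t x)) x =
      (\<Prod>t\<in>I. nn_cond_exp M F (\<lambda>x. f t (X t x)) x)"
    if "J \<subseteq> I" "\<And>t. t \<in> I \<Longrightarrow> f t \<in> borel_measurable borel"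
      "\<And>t. t \<in> I - J \<Longrightarrow> \<exists>A \<in> sets borel. f t = indicator A" for J f
    using finite_subset[OF that(1) \<open>finite I\<close>] that
  proof (induction J arbitrary: f rule: finite_induct)
    case empty
    then have "\<forall>t\<in>I. \<exists>A. A \<in> sets borel \<and> f t = indicator A" by auto
    then obtain A where A: "\<And>t. t \<in> I \<Longrightarrow> A t \<in> sets borel" "\<And>t. t \<in> I \<Longrightarrow> f t = indicator (A t)"
      by metis
    note [measurable] = A(1)
    have 1: "AE x in M. nn_cond_exp M F (\<lambda>x. ennreal (\<Prod>t\<in>I. indicat_real (A t) (X t x))) x =
        ennreal (real_cond_exp M F (\<lambda>x. \<Prod>t\<in>I. indicat_real (A t) (X t x)) x)"
      by (intro nn_cond_exp_eq_real_cond_exp) (auto intro!: prod_nonneg prod_le_1)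
    have 2: "AE x in M. real_cond_exp M F (\<lambda>x. \<Prod>t\<in>I. indicat_real (A t) (X t x)) x =
        (\<Prod>t\<in>I. real_cond_exp M F (\<lambda>x. indicat_real (A t) (X t x)) x)"
      using indep A(1) by (simp add: cond_indep_vars_def)
    have 3: "AE x in M. \<forall>t\<in>I. nn_cond_exp M F (\<lambda>x. ennreal (indicat_real (A t) (X t x))) x =
        ennreal (real_cond_exp M F (\<lambda>x. indicat_real (A t) (X t x)) x)"
      using \<open>finite I\<close> by (intro AE_finite_allI nn_cond_exp_eq_real_cond_exp) auto
    have 4: "AE x in M. \<forall>t\<in>I. 0 \<le> real_cond_exp M F (\<lambda>x. indicat_real (A t) (X t x)) x"
      using \<open>finite I\<close> by (intro AE_finite_allI real_cond_exp_pos) auto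
    have ind: "ennreal (\<Prod>t\<in>I. indicat_real (A t) (X t x)) = (\<Prod>t\<in>I. f t (X t x))" for x
      by (subst prod_ennreal[symmetric]) (auto simp: A ennreal_indicator intro!: prod.cong)
    from 1 2 3 4 show ?case
      by eventually_elim (simp add: ind A ennreal_indicator prod_ennreal[symmetric] cong: prod.cong)
  next
    case (insert j J)
    then have j: "j \<in> I" and J: "J \<subseteq> I" by auto
    define R where "R = (\<lambda>x. \<Prod>t\<in>I - {j}. f t (X t x))"
    define Q where "Q = (\<lambda>x. \<Prod>t\<in>I - {j}. nn_cond_exp M F (\<lambda>x. f t (X t x)) x)"
    have [measurable]: "R \<in> borel_measurable M"
      unfolding R_def by (intro borel_measurable_prod_ennreal measurable_compose[OF X insert.prems(2)]) auto
    have "AE x in M. nn_cond_exp M F (\<lambda>x. f j (X j x) * R x) x =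
        nn_cond_exp M F (\<lambda>x. f j (X j x)) x * Q x"
    proof (rule nn_cond_exp_mult_indicatorI[where N = borel and X = "X j" and R = R and Q = Q and h = "f j"])
      fix A :: "real set" assume A: "A \<in> sets borel"
      \<comment> \<open>With an indicator at \<open>j\<close> the induction hypothesis for
        \<open>J\<close> applies; \<open>nn_cond_exp_mult_indicatorI\<close> then restores
        \<open>f j\<close>.\<close>
      define f' where "f' = f(j := indicator A)"
      have "AE x in M. nn_cond_exp M F (\<lambda>x. \<Prod>t\<in>I. f' t (X t x)) x =
          (\<Prod>t\<in>I. nn_cond_exp M F (\<lambda>x. f' t (X t x)) x)"
        using insert.prems A by (intro insert.IH) (auto simp: f'_def)
      moreover have "(\<Prod>t\<in>I. f' t (X t x)) = indicator A (X j x) * R x" for x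
        unfolding prod.remove[OF \<open>finite I\<close> j] by (simp add: f'_def R_def)
      moreover have "(\<Prod>t\<in>I. nn_cond_exp M F (\<lambda>x. f' t (X t x)) x) =
          nn_cond_exp M F (\<lambda>x. indicator A (X j x)) x * Q x" for x
        unfolding prod.remove[OF \<open>finite I\<close> j] by (simp add: f'_def Q_def)
      ultimately show "AE x in M. nn_cond_exp M F (\<lambda>x. indicator A (X j x) * R x) x =
          nn_cond_exp M F (\<lambda>x. indicator A (X j x)) x * Q x"
        by simp
    qed (use j insert.prems in auto)
    then show ?case
      unfolding prod.remove[OF \<open>finite I\<close> j] R_def Q_def .
  qed
  from this[of I f] assms(4) show ?thesis by auto
qed

end

text \<open>Allows \<open>\<sigma>\<^sup>2\<close>, which may be 0, to be replaced by a positive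
  variance proxy before the tail bounds divide by it.\<close>

lemma cond_subgaussian_mono:
  assumes "cond_subgaussian M F v X" "v \<le> v'"
  shows "cond_subgaussian M F v' X"
  unfolding cond_subgaussian_def
proof (intro conjI allI)
  fix l
  have "ennreal (exp (l\<^sup>2 * v / 2)) \<le> ennreal (exp (l\<^sup>2 * v' / 2))"
    using assms(2) by (intro ennreal_leI) (auto intro: mult_left_mono)
  moreover have "AE \<omega> in M. nn_cond_exp M F (\<lambda>\<omega>'. ennreal (exp (l * X \<omega>'))) \<omega> \<le> ennreal (exp (l\<^sup>2 * v / 2))"
    using assms(1) by (simp add: cond_subgaussian_def)
  ultimately show "AE \<omega> in M. nn_cond_exp M F (\<lambda>\<omega>'. ennreal (exp (l * X \<omega>'))) \<omega> \<le> ennreal (exp (l\<^sup>2 * v' / 2))"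
    by (auto elim!: eventually_mono intro: order_trans)
qed (use assms in \<open>simp add: cond_subgaussian_def\<close>)

section \<open>Exponential moments and tails of sums of errors\<close>

context finite_measure_subalgebra
begin

text \<open>The conditional moment bound is integrated over a set \<open>D\<close> of
  \<open>F\<close>. The resulting factor \<open>emeasure M D\<close> is what later makes random
  index sets possible.\<close>

lemma cond_subgaussian_sum_mgf:
  fixes X :: "'i \<Rightarrow> 'a \<Rightarrow> real"
  assumes "finite I" and indep: "cond_indep_vars M F I X"
    and sub: "\<And>t. t \<in> I \<Longrightarrow> cond_subgaussian M F v (X t)"
    and "S \<subseteq> I" and D [measurable]: "D \<in> sets F"
  shows "(\<integral>\<^sup>+x. indicator D x * ennreal (exp (l * (\<Sum>t\<in>S. X t x))) \<partial>M)
    \<le> ennreal (exp (l\<^sup>2 * v / 2 * card S)) * emeasure M D"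
proof -
  \<comment> \<open>\<open>cond_indep_vars\<close> speaks of products over all of \<open>I\<close>,
    so the indices outside \<open>S\<close> receive the factor 1.\<close>
  define f :: "'i \<Rightarrow> real \<Rightarrow> ennreal" where "f t u = (if t \<in> S then ennreal (exp (l * u)) else 1)" for t u
  have X [measurable]: "X t \<in> borel_measurable M" if "t \<in> I" for t
    using sub[OF that] by (simp add: cond_subgaussian_def)
  have f [measurable]: "f t \<in> borel_measurable borel" for t
    unfolding f_def by measurable
  have [measurable]: "D \<in> sets M"
    using D subalg by (auto simp: subalgebra_def)
  have "finite S"
    using \<open>S \<subseteq> I\<close> \<open>finite I\<close> by (rule finite_subset)
  have prod_f: "(\<Prod>t\<in>I. f t (X t x)) = ennreal (exp (l * (\<Sum>t\<in>S. X t x)))" for x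
  proof -
    have "(\<Prod>t\<in>I. f t (X t x)) = (\<Prod>t\<in>S. ennreal (exp (l * X t x)))"
      using \<open>finite I\<close> \<open>S \<subseteq> I\<close> by (intro prod.mono_neutral_cong_right) (auto simp: f_def)
    then show ?thesis
      by (simp add: prod_ennreal exp_sum[OF \<open>finite S\<close>, symmetric] sum_distrib_left)
  qed
  have "AE x in M. \<forall>t\<in>I. nn_cond_exp M F (\<lambda>x. f t (X t x)) x \<le>
      (if t \<in> S then ennreal (exp (l\<^sup>2 * v / 2)) else 1)"
  proof (intro AE_finite_allI \<open>finite I\<close>)
    fix t assume "t \<in> I"
    show "AE x in M. nn_cond_exp M F (\<lambda>x. f t (X t x)) x \<le> (if t \<in> S then ennreal (exp (l\<^sup>2 * v / 2)) else 1)"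
    proof (cases "t \<in> S")
      case True
      then show ?thesis
        using sub[OF \<open>t \<in> I\<close>] by (simp add: f_def cond_subgaussian_def)
    next
      case False
      have "AE x in M. 1 = nn_cond_exp M F (\<lambda>_. 1) x"
        by (intro nn_cond_exp_F_meas) auto
      then show ?thesis
        using False by (auto simp: f_def)
    qed
  qed
  moreover have "AE x in M. nn_cond_exp M F (\<lambda>x. \<Prod>t\<in>I. f t (X t x)) x =
      (\<Prod>t\<in>I. nn_cond_exp M F (\<lambda>x. f t (X t x)) x)"
    using \<open>finite I\<close> X indep f by (rule nn_cond_exp_prod_cond_indep)
  ultimately have "AE x in M. nn_cond_exp M F (\<lambda>x. \<Prod>t\<in>I. f t (X t x)) x \<le>
      (\<Prod>t\<in>I. if t \<in> S then ennreal (exp (l\<^sup>2 * v / 2)) else 1)"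
    by eventually_elim (auto intro!: prod_mono_ennreal)
  also have "(\<Prod>t\<in>I. if t \<in> S then ennreal (exp (l\<^sup>2 * v / 2)) else 1) = ennreal (exp (l\<^sup>2 * v / 2 * card S))"
    using \<open>finite I\<close> \<open>S \<subseteq> I\<close>
    by (simp add: prod.If_cases Int_absorb1 ennreal_power exp_of_nat_mult[symmetric] mult.commute)
  finally have bound: "AE x in M. nn_cond_exp M F (\<lambda>x. \<Prod>t\<in>I. f t (X t x)) x \<le> ennreal (exp (l\<^sup>2 * v / 2 * card S))" .
  have "(\<integral>\<^sup>+x. indicator D x * (\<Prod>t\<in>I. f t (X t x)) \<partial>M) =
      (\<integral>\<^sup>+x. indicator D x * nn_cond_exp M F (\<lambda>x. \<Prod>t\<in>I. f t (X t x)) x \<partial>M)"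
    by (rule nn_cond_exp_intg[symmetric]) measurable
  also have "\<dots> \<le> (\<integral>\<^sup>+x. ennreal (exp (l\<^sup>2 * v / 2 * card S)) * indicator D x \<partial>M)"
    using bound by (intro nn_integral_mono_AE) (auto simp: indicator_def)
  also have "\<dots> = ennreal (exp (l\<^sup>2 * v / 2 * card S)) * emeasure M D"
    by (simp add: nn_integral_cmult_indicator)
  finally show ?thesis by (simp add: prod_f)
qed

text \<open>Chernoff bound restricted to \<open>D\<close>; the sign \<open>\<epsilon>\<close> yields
  both tails from one argument.\<close>

lemma cond_subgaussian_sum_tail:
  fixes X :: "'i \<Rightarrow> 'a \<Rightarrow> real"
  assumes "finite I" and indep: "cond_indep_vars M F I X"
    and sub: "\<And>t. t \<in> I \<Longrightarrow> cond_subgaussian M F v (X t)"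
    and "S \<subseteq> I" and D [measurable]: "D \<in> sets F"
    and "0 < v" "0 \<le> z" and \<epsilon>: "\<bar>\<epsilon>\<bar> = 1"
  shows "emeasure M {x \<in> D. z * sqrt (card S) < \<epsilon> * (\<Sum>t\<in>S. X t x)}
    \<le> ennreal (exp (- z\<^sup>2 / (2 * v))) * emeasure M D"
proof (cases "S = {}")
  case False
  have "finite S"
    using \<open>S \<subseteq> I\<close> \<open>finite I\<close> by (rule finite_subset)
  then have k: "0 < card S"
    using False by (simp add: card_gt_0_iff)
  have [measurable]: "D \<in> sets M"
    using D subalg by (auto simp: subalgebra_def)
  have [measurable]: "X t \<in> borel_measurable M" if "t \<in> S" for t
    using sub[of t] that \<open>S \<subseteq> I\<close> by (auto simp: cond_subgaussian_def)
  \<comment> \<open>Minimiser of the exponent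
    \<open>- l * z * sqrt k + l\<^sup>2 * v / 2 * k\<close> with \<open>k = card S\<close>; the
    minimum \<open>- z\<^sup>2 / (2 * v)\<close> is the same for every \<open>k\<close>.\<close>
  define l where "l = z / (v * sqrt (card S))"
  have "0 \<le> l"
    using \<open>0 < v\<close> \<open>0 \<le> z\<close> by (simp add: l_def)
  have \<epsilon>2: "\<epsilon>\<^sup>2 = 1"
    using \<epsilon> by (metis power2_abs power_one)
  have "D \<subseteq> space M"
    using D sets.sets_into_space[OF \<open>D \<in> sets M\<close>] by simp
  then have "{x \<in> D. z * sqrt (card S) < \<epsilon> * (\<Sum>t\<in>S. X t x)} = D \<inter> {x \<in> space M. z * sqrt (card S) < \<epsilon> * (\<Sum>t\<in>S. X t x)}"
    by auto
  then have B [measurable]: "{x \<in> D. z * sqrt (card S) < \<epsilon> * (\<Sum>t\<in>S. X t x)} \<in> sets M"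
    by simp
  have "emeasure M {x \<in> D. z * sqrt (card S) < \<epsilon> * (\<Sum>t\<in>S. X t x)} =
      (\<integral>\<^sup>+x. indicator {x \<in> D. z * sqrt (card S) < \<epsilon> * (\<Sum>t\<in>S. X t x)} x \<partial>M)"
    by simp
  also have "\<dots> \<le> (\<integral>\<^sup>+x. ennreal (exp (- l * z * sqrt (card S))) *
      (indicator D x * ennreal (exp ((l * \<epsilon>) * (\<Sum>t\<in>S. X t x)))) \<partial>M)"
  proof (rule nn_integral_mono)
    fix x
    have "1 \<le> exp (- l * z * sqrt (card S)) * exp ((l * \<epsilon>) * (\<Sum>t\<in>S. X t x))"
      if "z * sqrt (card S) < \<epsilon> * (\<Sum>t\<in>S. X t x)"
      using mult_left_mono[OF less_imp_le[OF that] \<open>0 \<le> l\<close>]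
      by (simp add: exp_add[symmetric] mult.assoc)
    then show "(indicator {x \<in> D. z * sqrt (card S) < \<epsilon> * (\<Sum>t\<in>S. X t x)} x :: ennreal) \<le>
        ennreal (exp (- l * z * sqrt (card S))) * (indicator D x * ennreal (exp ((l * \<epsilon>) * (\<Sum>t\<in>S. X t x))))"
      by (auto simp: indicator_def ennreal_mult[symmetric])
  qed
  also have "\<dots> = ennreal (exp (- l * z * sqrt (card S))) *
      (\<integral>\<^sup>+x. indicator D x * ennreal (exp ((l * \<epsilon>) * (\<Sum>t\<in>S. X t x))) \<partial>M)"
    by (rule nn_integral_cmult) measurable
  also have "\<dots> \<le> ennreal (exp (- l * z * sqrt (card S))) *
      (ennreal (exp ((l * \<epsilon>)\<^sup>2 * v / 2 * card S)) * emeasure M D)"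
    using assms by (intro mult_left_mono cond_subgaussian_sum_mgf) auto
  also have "\<dots> = ennreal (exp (- l * z * sqrt (card S) + l\<^sup>2 * v / 2 * card S)) * emeasure M D"
    by (simp add: mult.assoc[symmetric] ennreal_mult[symmetric] exp_add[symmetric] power_mult_distrib \<epsilon>2)
  also have "- l * z * sqrt (card S) + l\<^sup>2 * v / 2 * card S = - z\<^sup>2 / (2 * v)"
    using k \<open>0 < v\<close> by (simp add: l_def field_simps power2_eq_square)
  finally show ?thesis .
qed simp

text \<open>The index set is determined by \<open>F\<close>, so the space splits into pieces of
  \<open>F\<close> on which it is constant. The bound on each piece carries the measure of that
  piece, so summing over all \<open>S\<close> costs no factor for the number of subsets; the 2
  counts the tails.\<close>

lemma cond_subgaussian_random_sum_tail:
  fixes X :: "'i \<Rightarrow> 'a \<Rightarrow> real"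
  assumes "finite I" and indep: "cond_indep_vars M F I X"
    and sub: "\<And>t. t \<in> I \<Longrightarrow> cond_subgaussian M F v (X t)"
    and W: "\<And>x. x \<in> space M \<Longrightarrow> W x \<subseteq> I"
    and D: "\<And>S. S \<subseteq> I \<Longrightarrow> {x \<in> space M. W x = S} \<in> sets F"
    and "0 < v" "0 \<le> z"
  shows "{x \<in> space M. z * sqrt (card (W x)) < \<bar>\<Sum>t\<in>W x. X t x\<bar>} \<in> sets M" (is "?B \<in> _")
    and "emeasure M {x \<in> space M. z * sqrt (card (W x)) < \<bar>\<Sum>t\<in>W x. X t x\<bar>}
      \<le> 2 * ennreal (exp (- z\<^sup>2 / (2 * v))) * emeasure M (space M)"
proof -
  define D' where "D' S = {x \<in> space M. W x = S}" for S
  define B where "B S \<epsilon> = {x \<in> D' S. z * sqrt (card S) < \<epsilon> * (\<Sum>t\<in>S. X t x)}" for S and \<epsilon> :: real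
  have D'F: "D' S \<in> sets F" and D' [measurable]: "D' S \<in> sets M" if "S \<subseteq> I" for S
    using D[OF that] subalg by (auto simp: subalgebra_def D'_def)
  have B: "B S \<epsilon> \<in> sets M" if "S \<subseteq> I" for S \<epsilon>
  proof -
    have [measurable]: "X t \<in> borel_measurable M" if "t \<in> S" for t
      using sub[of t] that \<open>S \<subseteq> I\<close> by (auto simp: cond_subgaussian_def)
    have "B S \<epsilon> = D' S \<inter> {x \<in> space M. z * sqrt (card S) < \<epsilon> * (\<Sum>t\<in>S. X t x)}"
      by (auto simp: B_def D'_def)
    then show ?thesis
      using that by simp
  qed
  have eq: "?B = (\<Union>S\<in>Pow I. B S 1 \<union> B S (-1))"
    using W by (auto simp: B_def D'_def abs_if split: if_splits)
  show "?B \<in> sets M"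
    unfolding eq using \<open>finite I\<close> B by auto
  have "emeasure M ?B \<le> (\<Sum>S\<in>Pow I. emeasure M (B S 1 \<union> B S (-1)))"
    unfolding eq using \<open>finite I\<close> B by (intro emeasure_subadditive_finite) auto
  also have "\<dots> \<le> (\<Sum>S\<in>Pow I. 2 * ennreal (exp (- z\<^sup>2 / (2 * v))) * emeasure M (D' S))"
  proof (rule sum_mono)
    fix S assume "S \<in> Pow I"
    then have "S \<subseteq> I" by simp
    have "emeasure M (B S 1 \<union> B S (-1)) \<le> emeasure M (B S 1) + emeasure M (B S (-1))"
      using B[OF \<open>S \<subseteq> I\<close>] by (intro emeasure_subadditive) auto
    also have "\<dots> \<le> ennreal (exp (- z\<^sup>2 / (2 * v))) * emeasure M (D' S) +
        ennreal (exp (- z\<^sup>2 / (2 * v))) * emeasure M (D' S)"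
      unfolding B_def using assms \<open>S \<subseteq> I\<close> D'F[OF \<open>S \<subseteq> I\<close>]
      by (intro add_mono cond_subgaussian_sum_tail) auto
    finally show "emeasure M (B S 1 \<union> B S (-1)) \<le> 2 * ennreal (exp (- z\<^sup>2 / (2 * v))) * emeasure M (D' S)"
      by (simp only: mult_2 distrib_right)
  qed
  also have "\<dots> = 2 * ennreal (exp (- z\<^sup>2 / (2 * v))) * emeasure M (\<Union>S\<in>Pow I. D' S)"
  proof -
    have "(\<Sum>S\<in>Pow I. emeasure M (D' S)) = emeasure M (\<Union>S\<in>Pow I. D' S)"
      using \<open>finite I\<close> D' by (intro sum_emeasure) (auto simp: disjoint_family_on_def D'_def)
    then show ?thesis
      by (simp only: sum_distrib_left[symmetric])
  qed
  also have "\<dots> \<le> 2 * ennreal (exp (- z\<^sup>2 / (2 * v))) * emeasure M (space M)"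
    using D' \<open>finite I\<close> by (intro mult_left_mono emeasure_mono) (auto simp: D'_def)
  finally show "emeasure M ?B \<le> 2 * ennreal (exp (- z\<^sup>2 / (2 * v))) * emeasure M (space M)" .
qed

end

section \<open>The sigma-algebra of the design and the noise over all windows\<close>

lemma measurable_gen_algebra:
  assumes "t \<in> I"
  shows "X t \<in> borel_measurable (gen_algebra M I X)"
proof -
  have "(\<lambda>\<omega>. \<lambda>t\<in>I. X t \<omega>) \<in> gen_algebra M I X \<rightarrow>\<^sub>M (\<Pi>\<^sub>M t\<in>I. borel)"
    unfolding gen_algebra_def by (rule measurable_vimage_algebra1) (auto simp: space_PiM)
  from measurable_compose[OF this measurable_component_singleton[OF assms]] assms
  show ?thesis by simp
qed

lemma subalgebra_gen_algebra:
  assumes "\<And>t. t \<in> I \<Longrightarrow> X t \<in> borel_measurable M"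
  shows "subalgebra M (gen_algebra M I X)"
proof -
  have "(\<lambda>\<omega>. \<lambda>t\<in>I. X t \<omega>) \<in> M \<rightarrow>\<^sub>M (\<Pi>\<^sub>M t\<in>I. borel)"
    using assms by (intro measurable_restrict) auto
  then show ?thesis
    unfolding subalgebra_def gen_algebra_def by (simp add: sets_image_in_sets)
qed

text \<open>A window is a function of the design alone, so the tail bound for random index sets
  applies with the design as conditioning; a union bound over the pairs \<open>(r, s)\<close>
  contributes \<open>n\<^sup>2\<close>.\<close>

lemma (in prob_space) window_noise_bound:
  fixes w e :: "nat \<Rightarrow> 'a \<Rightarrow> real"
  assumes w [measurable]: "\<And>t. t \<in> {1..n} \<Longrightarrow> w t \<in> borel_measurable M"
    and indep: "cond_indep_vars M (gen_algebra M {1..n} w) {1..n} e"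
    and sub: "\<And>t. t \<in> {1..n} \<Longrightarrow> cond_subgaussian M (gen_algebra M {1..n} w) v (e t)"
    and "0 < v" "0 \<le> z"
  defines "N \<equiv> {\<omega> \<in> space M. \<exists>r\<in>{1..n}. \<exists>s\<in>{1..n}.
      z * sqrt (card (window n (\<lambda>t. w t \<omega>) r s)) < \<bar>\<Sum>t\<in>window n (\<lambda>t. w t \<omega>) r s. e t \<omega>\<bar>}"
  shows "N \<in> events" and "prob N \<le> 2 * (real n)\<^sup>2 * exp (- z\<^sup>2 / (2 * v))"
proof -
  let ?F = "gen_algebra M {1..n} w"
  interpret finite_measure_subalgebra M ?F
    by unfold_locales (intro subalgebra_gen_algebra w)
  define B where "B r s = {\<omega> \<in> space M.
      z * sqrt (card (window n (\<lambda>t. w t \<omega>) r s)) < \<bar>\<Sum>t\<in>window n (\<lambda>t. w t \<omega>) r s. e t \<omega>\<bar>}" for r s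
  have win: "{\<omega> \<in> space M. window n (\<lambda>t. w t \<omega>) r s = S} \<in> sets ?F"
    if "r \<in> {1..n}" "s \<in> {1..n}" "S \<subseteq> {1..n}" for r s S
  proof -
    note [measurable] = measurable_gen_algebra[of _ "{1..n}" w M]
    have sp: "space ?F = space M"
      by (simp add: gen_algebra_def)
    have "{\<omega> \<in> space M. window n (\<lambda>t. w t \<omega>) r s = S} =
        {\<omega> \<in> space ?F. \<forall>t\<in>{1..n}. (w r \<omega> \<le> w t \<omega> \<and> w t \<omega> \<le> w s \<omega>) \<longleftrightarrow> t \<in> S}"
      using that(3) unfolding sp by (auto simp: window_def)
    also have "\<dots> \<in> sets ?F"
      using that(1,2) by measurable
    finally show ?thesis .
  qed
  have B: "B r s \<in> events" "prob (B r s) \<le> 2 * exp (- z\<^sup>2 / (2 * v))"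
    if "r \<in> {1..n}" "s \<in> {1..n}" for r s
  proof -
    have W: "window n (\<lambda>t. w t \<omega>) r s \<subseteq> {1..n}" for \<omega>
      by (auto simp: window_def)
    note tail = cond_subgaussian_random_sum_tail[OF _ indep sub W win[OF that] \<open>0 < v\<close> \<open>0 \<le> z\<close>]
    have *: "B r s \<in> events"
      "emeasure M (B r s) \<le> 2 * ennreal (exp (- z\<^sup>2 / (2 * v))) * emeasure M (space M)"
      unfolding B_def by (rule tail; simp)+
    then show "B r s \<in> events" by simp
    have "2 * ennreal (exp (- z\<^sup>2 / (2 * v))) = ennreal (2 * exp (- z\<^sup>2 / (2 * v)))"
      by (simp add: ennreal_mult)
    then show "prob (B r s) \<le> 2 * exp (- z\<^sup>2 / (2 * v))"
      using *(2) by (simp add: emeasure_eq_measure prob_space)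
  qed
  have N: "N = (\<Union>p\<in>{1..n} \<times> {1..n}. B (fst p) (snd p))"
    unfolding N_def B_def by force
  show "N \<in> events"
    unfolding N using B by auto
  have "prob N \<le> (\<Sum>p\<in>{1..n} \<times> {1..n}. prob (B (fst p) (snd p)))"
    unfolding N using B by (intro finite_measure_subadditive_finite) auto
  also have "\<dots> \<le> real (card ({1..n} \<times> {1..n})) * (2 * exp (- z\<^sup>2 / (2 * v)))"
    by (intro sum_bounded_above B) (auto simp: mem_Times_iff)
  finally show "prob N \<le> 2 * (real n)\<^sup>2 * exp (- z\<^sup>2 / (2 * v))"
    by (simp add: power2_eq_square)
qed

section \<open>Design points in short intervals\<close>

text \<open>Markov's inequality for \<open>exp (- count)\<close>. If \<open>q\<close> is the
  probability of \<open>A\<close> under one variable, its factor has mean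
  \<open>1 - (1 - exp (- 1)) * q \<le> 1 - q / 2 \<le> exp (- p / 2)\<close>; the threshold
  \<open>card I * p / 4\<close> gives back half of the total exponent.\<close>

lemma (in prob_space) chernoff_count:
  fixes X :: "'i \<Rightarrow> 'a \<Rightarrow> real" and p :: real
  assumes "finite I" and indep: "indep_vars (\<lambda>_. borel) X I" and A [measurable]: "A \<in> sets borel"
    and p: "\<And>t. t \<in> I \<Longrightarrow> p \<le> prob {\<omega> \<in> space M. X t \<omega> \<in> A}"
  shows "{\<omega> \<in> space M. card {t \<in> I. X t \<omega> \<in> A} \<le> card I * p / 4} \<in> events" (is "?B \<in> _")
    and "prob {\<omega> \<in> space M. card {t \<in> I. X t \<omega> \<in> A} \<le> card I * p / 4} \<le> exp (- (card I * p / 4))"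
proof -
  have X [measurable]: "X t \<in> borel_measurable M" if "t \<in> I" for t
    using indep that by (simp add: indep_vars_def)
  define Y where "Y t \<omega> = ennreal (exp (- indicat_real A (X t \<omega>)))" for t \<omega>
  have cnt: "real (card {t \<in> I. X t \<omega> \<in> A}) = (\<Sum>t\<in>I. indicat_real A (X t \<omega>))" for \<omega>
    using \<open>finite I\<close> by (simp add: indicator_def sum.If_cases Int_def)
  show B [measurable]: "?B \<in> events"
    unfolding cnt by measurable
  have Y_int: "(\<integral>\<^sup>+\<omega>. Y t \<omega> \<partial>M) \<le> ennreal (exp (- p / 2))" if "t \<in> I" for t
  proof -
    let ?E = "{\<omega> \<in> space M. X t \<omega> \<in> A}"
    have E [measurable]: "?E \<in> events"
      using that by measurable
    have "Y t \<omega> = ennreal (1 - (1 - exp (- 1)) * indicat_real ?E \<omega>)" if "\<omega> \<in> space M" for \<omega>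
      using that by (simp add: Y_def indicator_def)
    then have "(\<integral>\<^sup>+\<omega>. Y t \<omega> \<partial>M) = (\<integral>\<^sup>+\<omega>. ennreal (1 - (1 - exp (- 1)) * indicat_real ?E \<omega>) \<partial>M)"
      by (intro nn_integral_cong) auto
    also have "\<dots> = ennreal (expectation (\<lambda>\<omega>. 1 - (1 - exp (- 1)) * indicat_real ?E \<omega>))"
      by (intro nn_integral_eq_integral) (auto simp: emeasure_eq_measure intro!: mult_le_one)
    also have "expectation (\<lambda>\<omega>. 1 - (1 - exp (- 1)) * indicat_real ?E \<omega>) = 1 - (1 - exp (- 1)) * prob ?E"
      by (subst Bochner_Integration.integral_diff) (auto simp: prob_space emeasure_eq_measure)
    also have "\<dots> \<le> 1 - 1 / 2 * prob ?E"
    proof -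
      have "exp (- 1) \<le> (1 / 2 :: real)"
        using exp_ge_add_one_self[of 1] by (simp add: exp_minus field_simps)
      then show ?thesis
        by (intro diff_left_mono mult_right_mono) auto
    qed
    also have "\<dots> \<le> 1 + (- p / 2)"
      using p[OF \<open>t \<in> I\<close>] by simp
    also have "\<dots> \<le> exp (- p / 2)"
      by (rule exp_ge_add_one_self)
    finally show ?thesis by (simp add: ennreal_leI)
  qed
  have "indep_vars (\<lambda>_. borel) Y I"
    unfolding Y_def by (rule indep_vars_compose2[OF indep]) measurable
  then have prod_Y: "(\<integral>\<^sup>+\<omega>. (\<Prod>t\<in>I. Y t \<omega>) \<partial>M) = (\<Prod>t\<in>I. \<integral>\<^sup>+\<omega>. Y t \<omega> \<partial>M)"
    using \<open>finite I\<close> by (intro indep_vars_nn_integral) auto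
  have [measurable]: "Y t \<in> borel_measurable M" if "t \<in> I" for t
    using that unfolding Y_def by measurable
  have "emeasure M ?B = (\<integral>\<^sup>+\<omega>. indicator ?B \<omega> \<partial>M)"
    by (rule nn_integral_indicator[OF B, symmetric])
  also have "\<dots> \<le> (\<integral>\<^sup>+\<omega>. ennreal (exp (card I * p / 4)) * (\<Prod>t\<in>I. Y t \<omega>) \<partial>M)"
  proof (rule nn_integral_mono)
    fix \<omega>
    have "(\<Prod>t\<in>I. Y t \<omega>) = ennreal (exp (- real (card {t \<in> I. X t \<omega> \<in> A})))"
      using \<open>finite I\<close> by (simp add: Y_def cnt prod_ennreal sum_negf[symmetric] exp_sum)
    then show "(indicator ?B \<omega> :: ennreal) \<le> ennreal (exp (card I * p / 4)) * (\<Prod>t\<in>I. Y t \<omega>)"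
      by (auto simp: indicator_def ennreal_mult[symmetric] exp_add[symmetric])
  qed
  also have "\<dots> = ennreal (exp (card I * p / 4)) * (\<Prod>t\<in>I. \<integral>\<^sup>+\<omega>. Y t \<omega> \<partial>M)"
    by (subst nn_integral_cmult) (auto simp: prod_Y)
  also have "\<dots> \<le> ennreal (exp (card I * p / 4)) * (\<Prod>t\<in>I. ennreal (exp (- p / 2)))"
    using Y_int by (intro mult_left_mono prod_mono_ennreal) auto
  also have "\<dots> = ennreal (exp (card I * p / 4 + card I * (- p / 2)))"
    by (simp only: prod_constant ennreal_power exp_ge_zero exp_of_nat_mult[symmetric] exp_add ennreal_mult)
  also have "card I * p / 4 + card I * (- p / 2) = - (card I * p / 4)"
    by simp
  finally show "prob ?B \<le> exp (- (card I * p / 4))"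
    by (simp add: emeasure_eq_measure)
qed

lemma (in prob_space) prob_interval_ge:
  fixes X :: "'a \<Rightarrow> real"
  assumes X: "distributed M lborel X (\<lambda>u. ennreal (f u))" and "\<And>u. u \<in> {a..b} \<Longrightarrow> c \<le> f u"
    and "0 \<le> c" "a \<le> b"
  shows "c * (b - a) \<le> prob {\<omega> \<in> space M. X \<omega> \<in> {a..b}}"
proof -
  have "ennreal (c * (b - a)) = (\<integral>\<^sup>+u. ennreal c * indicator {a..b} u \<partial>lborel)"
    using assms by (simp add: nn_integral_cmult_indicator ennreal_mult)
  also have "\<dots> \<le> (\<integral>\<^sup>+u\<in>{a..b}. ennreal (f u) \<partial>lborel)"
    using assms(2) by (intro nn_integral_mono) (auto simp: indicator_def intro: ennreal_leI)
  also have "\<dots> = emeasure M (X -` {a..b} \<inter> space M)"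
    using X by (simp add: distributed_emeasure)
  also have "X -` {a..b} \<inter> space M = {\<omega> \<in> space M. X \<omega> \<in> {a..b}}"
    by auto
  finally show ?thesis
    by (simp add: emeasure_eq_measure)
qed

text \<open>The left ends \<open>k * d\<close> lie in \<open>{- R..R}\<close>, which confines
  \<open>k\<close>. The count enters the union bound over cells.\<close>

lemma card_cells_le:
  fixes U :: "real set" and d R :: real
  assumes "U \<subseteq> {- R..R}" "0 < d" "0 < R"
  shows "finite {k :: int. {real_of_int k * d..(real_of_int k + 1) * d} \<subseteq> U}"
    and "card {k :: int. {real_of_int k * d..(real_of_int k + 1) * d} \<subseteq> U} \<le> 2 * R / d + 1"
proof -
  have sub: "{k :: int. {real_of_int k * d..(real_of_int k + 1) * d} \<subseteq> U} \<subseteq> {\<lceil>- R / d\<rceil>..\<lfloor>R / d\<rfloor>}"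
  proof
    fix k :: int assume "k \<in> {k :: int. {real_of_int k * d..(real_of_int k + 1) * d} \<subseteq> U}"
    then have "k * d \<in> U"
      using \<open>0 < d\<close> by (auto simp: subset_iff distrib_right)
    then have "k * d \<in> {- R..R}"
      using assms(1) by blast
    then have "- R / d \<le> k" "k \<le> R / d"
      using \<open>0 < d\<close> by (auto simp: field_simps)
    then show "k \<in> {\<lceil>- R / d\<rceil>..\<lfloor>R / d\<rfloor>}"
      by (simp add: ceiling_le_iff le_floor_iff)
  qed
  then show "finite {k :: int. {real_of_int k * d..(real_of_int k + 1) * d} \<subseteq> U}"
    by (rule finite_subset) simp
  have "card {k :: int. {real_of_int k * d..(real_of_int k + 1) * d} \<subseteq> U} \<le> card {\<lceil>- R / d\<rceil>..\<lfloor>R / d\<rfloor>}"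
    using sub by (intro card_mono) auto
  moreover have "- R / d \<le> R / d"
    using assms by (simp add: field_simps)
  then have "real (card {\<lceil>- R / d\<rceil>..\<lfloor>R / d\<rfloor>}) \<le> 2 * R / d + 1"
    using assms by (simp, linarith)
  ultimately show "card {k :: int. {real_of_int k * d..(real_of_int k + 1) * d} \<subseteq> U} \<le> 2 * R / d + 1"
    by linarith
qed

text \<open>Rounding \<open>u / d\<close> up moves the left end by at most one cell length. This
  reduces a continuum of intervals to a grid.\<close>

lemma ex_cell_subset:
  fixes u d :: real
  assumes "0 < d"
  obtains k :: int where "{real_of_int k * d..(real_of_int k + 1) * d} \<subseteq> {u..u + 2 * d}"
proof
  have "u / d \<le> \<lceil>u / d\<rceil>" "\<lceil>u / d\<rceil> \<le> u / d + 1"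
    by linarith+
  then have "u / d * d \<le> \<lceil>u / d\<rceil> * d" "(real_of_int \<lceil>u / d\<rceil> + 1) * d \<le> (u / d + 2) * d"
    using assms by (intro mult_right_mono; linarith)+
  then have "u \<le> \<lceil>u / d\<rceil> * d" "(real_of_int \<lceil>u / d\<rceil> + 1) * d \<le> u + 2 * d"
    using assms by (auto simp: distrib_right)
  then show "{real_of_int \<lceil>u / d\<rceil> * d..(real_of_int \<lceil>u / d\<rceil> + 1) * d} \<subseteq> {u..u + 2 * d}"
    by auto
qed

text \<open>Each interval of length \<open>2 * d\<close> in \<open>U\<close> contains a grid cell,
  of probability at least \<open>c * d\<close>, so a sparse interval forces a sparse cell.
  \<open>G\<close> ranges over uncountably many \<open>u\<close>; covering it by the finite union of
  cell events avoids the question of its measurability.\<close>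

lemma (in prob_space) design_density_bound:
  fixes w :: "nat \<Rightarrow> 'a \<Rightarrow> real"
  assumes indep: "indep_vars (\<lambda>_. borel) w {1..n}"
    and dens: "\<And>t. t \<in> {1..n} \<Longrightarrow> distributed M lborel (w t) (\<lambda>u. ennreal (f u))"
    and f: "\<And>u. u \<in> U \<Longrightarrow> c \<le> f u" and "0 \<le> c"
    and U: "U \<subseteq> {- R..R}" "0 < d" "0 < R"
  defines "G \<equiv> {\<omega> \<in> space M. \<exists>u. {u..u + 2 * d} \<subseteq> U \<and>
      card {t \<in> {1..n}. u \<le> w t \<omega> \<and> w t \<omega> \<le> u + 2 * d} < n * (c * d) / 4}"
  obtains G' where "G' \<in> events" "G \<subseteq> G'"
    "prob G' \<le> (2 * R / d + 1) * exp (- (n * (c * d) / 4))"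
proof
  define K where "K = {k :: int. {real_of_int k * d..(real_of_int k + 1) * d} \<subseteq> U}"
  note K = card_cells_le[OF U, folded K_def]
  define B where "B k = {\<omega> \<in> space M. card {t \<in> {1..n}. w t \<omega> \<in> {real_of_int k * d..(real_of_int k + 1) * d}} \<le> n * (c * d) / 4}" for k
  have p: "c * d \<le> prob {\<omega> \<in> space M. w t \<omega> \<in> {real_of_int k * d..(real_of_int k + 1) * d}}"
    if "k \<in> K" "t \<in> {1..n}" for k t
  proof -
    have "c * ((real_of_int k + 1) * d - k * d) \<le> prob {\<omega> \<in> space M. w t \<omega> \<in> {real_of_int k * d..(real_of_int k + 1) * d}}"
      using that(1) U(2) by (intro prob_interval_ge[OF dens[OF that(2)]] f \<open>0 \<le> c\<close>)
        (auto simp: K_def distrib_right)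
    then show ?thesis
      by (simp add: distrib_right)
  qed
  have B: "B k \<in> events" "prob (B k) \<le> exp (- (n * (c * d) / 4))" if "k \<in> K" for k
  proof -
    note chernoff = chernoff_count[where A = "{real_of_int k * d..(real_of_int k + 1) * d}",
        OF finite_atLeastAtMost indep _ p[OF that], unfolded card_atLeastAtMost diff_Suc_1]
    show "B k \<in> events"
      unfolding B_def by (rule chernoff(1)) auto
    show "prob (B k) \<le> exp (- (n * (c * d) / 4))"
      unfolding B_def by (rule chernoff(2)) auto
  qed
  show "(\<Union>k\<in>K. B k) \<in> events"
    using K(1) B by auto
  show "G \<subseteq> (\<Union>k\<in>K. B k)"
  proof
    fix \<omega> assume "\<omega> \<in> G"
    then obtain u where u: "\<omega> \<in> space M" "{u..u + 2 * d} \<subseteq> U"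
      "card {t \<in> {1..n}. u \<le> w t \<omega> \<and> w t \<omega> \<le> u + 2 * d} < n * (c * d) / 4"
      by (auto simp: G_def)
    obtain k :: int where k: "{real_of_int k * d..(real_of_int k + 1) * d} \<subseteq> {u..u + 2 * d}"
      using ex_cell_subset[OF \<open>0 < d\<close>] by blast
    then have "card {t \<in> {1..n}. w t \<omega> \<in> {real_of_int k * d..(real_of_int k + 1) * d}} \<le>
        card {t \<in> {1..n}. u \<le> w t \<omega> \<and> w t \<omega> \<le> u + 2 * d}"
      by (intro card_mono) (auto simp: subset_iff)
    then have "real (card {t \<in> {1..n}. w t \<omega> \<in> {real_of_int k * d..(real_of_int k + 1) * d}}) \<le> n * (c * d) / 4"
      using u(3) by linarith
    then show "\<omega> \<in> (\<Union>k\<in>K. B k)"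
      using u(1,2) k by (intro UN_I[of k]) (auto simp: K_def B_def)
  qed
  have "prob (\<Union>k\<in>K. B k) \<le> (\<Sum>k\<in>K. prob (B k))"
    using K(1) B by (intro finite_measure_subadditive_finite) auto
  also have "\<dots> \<le> card K * exp (- (n * (c * d) / 4))"
    by (intro sum_bounded_above B)
  also have "\<dots> \<le> (2 * R / d + 1) * exp (- (n * (c * d) / 4))"
    using K(2) by (intro mult_right_mono) auto
  finally show "prob (\<Union>k\<in>K. B k) \<le> (2 * R / d + 1) * exp (- (n * (c * d) / 4))" .
qed

section \<open>Uniform bounds over an interval\<close>

lemma is_interval_inner_domain:
  assumes "is_interval U" "0 \<le> \<delta>"
  shows "is_interval (inner_domain U \<delta>)"
  unfolding is_interval_1
proof (intro ballI allI impI)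
  fix a b x assume ab: "a \<in> inner_domain U \<delta>" "b \<in> inner_domain U \<delta>" and x: "a \<le> x \<and> x \<le> b"
  have U: "a \<in> U" "b \<in> U" "a - \<delta> \<in> U" "b + \<delta> \<in> U"
    using ab \<open>0 \<le> \<delta>\<close> by (auto simp: inner_domain_def subset_iff)
  have mem: "t \<in> U" if "p \<in> U" "q \<in> U" "p \<le> t" "t \<le> q" for p q t
    using \<open>is_interval U\<close> that unfolding is_interval_1 by blast
  have "x \<in> U"
    using mem[OF U(1,2)] x by blast
  moreover have "t \<in> U" if "t \<in> {x - \<delta>..x + \<delta>}" for t
    by (rule mem[OF U(3,4)]) (use x that in simp_all)
  ultimately show "x \<in> inner_domain U \<delta>"
    by (auto simp only: inner_domain_def)
qed

text \<open>Monotonicity sandwiches the values between those at rational points, so countably many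
  conditions suffice although the fit need not be continuous.\<close>

lemma ball_abs_diff_measurable:
  fixes g :: "'a \<Rightarrow> real \<Rightarrow> real" and \<psi> :: "real \<Rightarrow> real"
  assumes V: "is_interval V" and \<psi>: "continuous_on V \<psi>"
    and mono: "\<And>\<omega>. \<omega> \<in> space M \<Longrightarrow> mono (g \<omega>)"
    and [measurable]: "\<And>u. (\<lambda>\<omega>. g \<omega> u) \<in> borel_measurable M"
  shows "{\<omega> \<in> space M. \<forall>u\<in>V. \<bar>g \<omega> u - \<psi> u\<bar> \<le> c} \<in> sets M"
proof -
  \<comment> \<open>Any other point of \<open>V\<close> has rationals of \<open>V\<close>
    arbitrarily close on both sides; a minimum or maximum of \<open>V\<close> does not, and is
    added.\<close>
  define D where "D = (V \<inter> \<rat>) \<union> {u \<in> V. \<forall>v\<in>V. u \<le> v} \<union> {u \<in> V. \<forall>v\<in>V. v \<le> u}"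
  have "{u \<in> V. \<forall>v\<in>V. u \<le> v} \<subseteq> {Inf V}" "{u \<in> V. \<forall>v\<in>V. v \<le> u} \<subseteq> {Sup V}"
    by (auto intro!: cInf_eq_minimum[symmetric] cSup_eq_maximum[symmetric])
  then have "countable {u \<in> V. \<forall>v\<in>V. u \<le> v}" "countable {u \<in> V. \<forall>v\<in>V. v \<le> u}"
    by (meson countable_subset countable_finite finite.intros)+
  then have "countable D"
    using countable_rat by (auto simp: D_def intro: countable_subset)
  have "D \<subseteq> V"
    by (auto simp: D_def)
  have bound: "\<bar>g \<omega> u - \<psi> u\<bar> \<le> c"
    if \<omega>: "\<omega> \<in> space M" and D: "\<forall>u\<in>D. \<bar>g \<omega> u - \<psi> u\<bar> \<le> c" and "u \<in> V" for \<omega> u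
  proof (cases "u \<in> D")
    case False
    then obtain v1 v2 where v: "v1 \<in> V" "v2 \<in> V" "v1 < u" "u < v2"
      using \<open>u \<in> V\<close> by (auto simp: D_def not_le)
    show ?thesis
    proof (rule field_le_epsilon)
      fix \<epsilon> :: real assume "0 < \<epsilon>"
      then obtain \<eta> where "0 < \<eta>" and \<eta>: "\<And>v. v \<in> V \<Longrightarrow> dist v u < \<eta> \<Longrightarrow> dist (\<psi> v) (\<psi> u) < \<epsilon>"
        using \<psi> \<open>u \<in> V\<close> unfolding continuous_on_iff by metis
      obtain q1 where q1: "q1 \<in> \<rat>" "max v1 (u - \<eta>) < q1" "q1 < u"
        using Rats_dense_in_real[of "max v1 (u - \<eta>)" u] v \<open>0 < \<eta>\<close> by auto
      obtain q2 where q2: "q2 \<in> \<rat>" "u < q2" "q2 < min v2 (u + \<eta>)"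
        using Rats_dense_in_real[of u "min v2 (u + \<eta>)"] v \<open>0 < \<eta>\<close> by auto
      have "q1 \<in> V" "q2 \<in> V"
        using V v \<open>u \<in> V\<close> q1 q2 unfolding is_interval_1 by (meson less_imp_le max_less_iff_conj min_less_iff_conj)+
      then have "q1 \<in> D" "q2 \<in> D"
        using q1 q2 by (auto simp: D_def)
      have "\<bar>\<psi> q1 - \<psi> u\<bar> < \<epsilon>" "\<bar>\<psi> q2 - \<psi> u\<bar> < \<epsilon>"
        using \<eta>[OF \<open>q1 \<in> V\<close>] \<eta>[OF \<open>q2 \<in> V\<close>] q1 q2 by (auto simp: dist_real_def)
      moreover have "g \<omega> q1 \<le> g \<omega> u" "g \<omega> u \<le> g \<omega> q2"
        using mono[OF \<omega>] q1 q2 by (auto simp: monoD)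
      ultimately show "\<bar>g \<omega> u - \<psi> u\<bar> \<le> c + \<epsilon>"
        using bspec[OF D \<open>q1 \<in> D\<close>] bspec[OF D \<open>q2 \<in> D\<close>] by linarith
    qed
  qed (use D in auto)
  have "{\<omega> \<in> space M. \<forall>u\<in>V. \<bar>g \<omega> u - \<psi> u\<bar> \<le> c} = {\<omega> \<in> space M. \<forall>u\<in>D. \<bar>g \<omega> u - \<psi> u\<bar> \<le> c}"
    using bound \<open>D \<subseteq> V\<close> by blast
  also have "\<dots> \<in> sets M"
    using \<open>countable D\<close> by measurable
  finally show ?thesis .
qed

lemma holder_imp_continuous_on:
  fixes \<psi> :: "real \<Rightarrow> real"
  assumes "\<And>u v. u \<in> U \<Longrightarrow> v \<in> U \<Longrightarrow> \<bar>\<psi> u - \<psi> v\<bar> \<le> C * \<bar>u - v\<bar> powr \<alpha>" and "0 < \<alpha>"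
  shows "continuous_on U \<psi>"
  unfolding continuous_on_def
proof
  fix u assume "u \<in> U"
  have "((\<lambda>v. \<bar>v - u\<bar>) \<longlongrightarrow> \<bar>u - u\<bar>) (at u within U)"
    by (intro tendsto_intros)
  then have "((\<lambda>v. \<bar>v - u\<bar> powr \<alpha>) \<longlongrightarrow> \<bar>u - u\<bar> powr \<alpha>) (at u within U)"
    using \<open>0 < \<alpha>\<close> by (intro tendsto_powr' tendsto_const) (auto intro: always_eventually)
  then have "((\<lambda>v. C * \<bar>v - u\<bar> powr \<alpha>) \<longlongrightarrow> 0) (at u within U)"
    by (intro tendsto_mult_right_zero) simp
  moreover have "\<forall>\<^sub>F v in at u within U. norm (\<psi> v - \<psi> u) \<le> C * \<bar>v - u\<bar> powr \<alpha>"
    unfolding eventually_at_filter using assms(1) \<open>u \<in> U\<close> by (intro always_eventually) auto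
  ultimately have "((\<lambda>v. \<psi> v - \<psi> u) \<longlongrightarrow> 0) (at u within U)"
    by (rule Lim_null_comparison[rotated])
  then show "(\<psi> \<longlongrightarrow> \<psi> u) (at u within U)"
    by (simp add: LIM_zero_iff)
qed

lemma regression_sample_indep_design:
  assumes "regression_sample M n U C \<sigma> \<psi> w e y"
  shows "prob_space.indep_vars M (\<lambda>_. borel) w {1..n}"
proof -
  interpret prob_space M
    using assms by (simp add: regression_sample_def)
  have "indep_vars (\<lambda>_. borel) (\<lambda>t \<omega>. (w t \<omega>, y t \<omega>)) {1..n}"
    using assms by (simp add: regression_sample_def iid_on_def)
  then have "indep_vars (\<lambda>_. borel) (\<lambda>t \<omega>. fst (w t \<omega>, y t \<omega>)) {1..n}"
    by (rule indep_vars_compose2) (intro borel_measurable_continuous_onI continuous_intros)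
  then show ?thesis by simp
qed

section \<open>Rates\<close>

text \<open>Ensures that the threshold \<open>n\<^sub>0\<close> exists: up to constants
  \<open>c_seq\<close> decays like \<open>rho_seq\<close>, but \<open>delta_seq\<close> only like a
  power of it with exponent below 1.\<close>

lemma eps_seq_tendsto_0:
  assumes "0 < \<alpha>" "0 < \<kappa>" 
  shows "eps_seq \<gamma> \<kappa> \<alpha> \<longlonglongrightarrow> 0"
proof -
  define \<beta> where "\<beta> = 1 / (2 * \<alpha> + 1)"
  have \<beta>: "0 < \<beta>" "\<beta> < 1"
    using assms by (auto simp: \<beta>_def)
  have 1: "(\<lambda>n. c_seq \<gamma> n / delta_seq \<kappa> \<alpha> n) \<longlonglongrightarrow> 0"
    unfolding c_seq_def delta_seq_def rho_seq_def \<beta>_def[symmetric]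
    using \<beta> \<open>0 < \<kappa>\<close> by real_asymp
  have 2: "(\<lambda>n. 1 / (real n * delta_seq \<kappa> \<alpha> n)) \<longlonglongrightarrow> 0"
    unfolding c_seq_def delta_seq_def rho_seq_def \<beta>_def[symmetric]
    using \<beta> \<open>0 < \<kappa>\<close> by real_asymp
  have "(\<lambda>n. max (c_seq \<gamma> n / delta_seq \<kappa> \<alpha> n) (sqrt (2 * (c_seq \<gamma> n / delta_seq \<kappa> \<alpha> n)))
       + 1 / (real n * delta_seq \<kappa> \<alpha> n)) \<longlonglongrightarrow> max 0 (sqrt (2 * 0)) + 0"
    by (intro tendsto_intros 1 2)
  then show ?thesis by (simp add: eps_seq_def[abs_def])
qed

text \<open>Up to logarithms \<open>n * delta_seq \<kappa> \<alpha> n\<close> grows like a positive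
  power of \<open>n\<close>, so the exponential beats both the number of cells and
  \<open>n powr \<gamma>\<close>.\<close>

lemma eventually_cell_bound:
  fixes R :: real
  assumes "0 < \<alpha>" "0 < \<kappa>" "0 < C" "0 < R" 
  shows "eventually (\<lambda>n. (2 * R / (delta_seq \<kappa> \<alpha> n / 2) + 1) * exp (- (real n * (C * (delta_seq \<kappa> \<alpha> n / 2)) / 4))
     \<le> real n powr (- \<gamma>)) sequentially"
proof -
  define \<beta> where "\<beta> = 1 / (2 * \<alpha> + 1)"
  have \<beta>: "0 < \<beta>" "\<beta> < 1"
    using assms by (auto simp: \<beta>_def)
  show ?thesis
    unfolding delta_seq_def rho_seq_def \<beta>_def[symmetric]
    using \<beta> assms by real_asymp
qed

text \<open>The balance behind \<open>delta_seq\<close>: up to constants, the noise level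
  \<open>sqrt (ln n / (n * \<delta>))\<close> equals the bias
  \<open>\<delta> powr \<alpha>\<close>.\<close>

lemma powr_rate_exponent:
  fixes \<rho> \<alpha> :: real
  assumes "0 \<le> \<rho>" "0 < \<alpha>"
  shows "sqrt (\<rho> / \<rho> powr (1 / (2 * \<alpha> + 1))) = \<rho> powr (\<alpha> / (2 * \<alpha> + 1))"
proof (cases "\<rho> = 0")
  case False
  then have "0 < \<rho>"
    using assms by simp
  have "\<rho> / \<rho> powr (1 / (2 * \<alpha> + 1)) = \<rho> powr (1 - 1 / (2 * \<alpha> + 1))"
    using \<open>0 < \<rho>\<close> by (simp add: powr_diff)
  also have "1 - 1 / (2 * \<alpha> + 1) = \<alpha> / (2 * \<alpha> + 1) * 2"
    using \<open>0 < \<alpha>\<close> by (simp add: field_simps)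
  also have "\<rho> powr (\<alpha> / (2 * \<alpha> + 1) * 2) = (\<rho> powr (\<alpha> / (2 * \<alpha> + 1)))\<^sup>2"
    by (subst powr_powr[symmetric]) simp
  finally show ?thesis by simp
qed simp

text \<open>Both constants precede the probability space, the regression function, the sample and
  the fit, so the bound is uniform in all of them. Measurability of the fit at each point makes the
  event measurable.\<close>

theorem theorem7:
  fixes U :: "real set" and \<alpha> C\<^sub>1 C\<^sub>2 \<sigma> \<kappa> \<gamma> :: real
  assumes "is_interval U" and "bounded U"
    and "0 < \<alpha>" and "\<alpha> \<le> 1" and "0 < C\<^sub>1" and "0 < C\<^sub>2" and "0 \<le> \<sigma>"
    and "0 < \<kappa>" and "2 < \<gamma>"
  shows "\<exists>n\<^sub>0 C. 0 < C \<and>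
    (2 \<le> n\<^sub>0 \<and> eps_seq \<gamma> \<kappa> \<alpha> n\<^sub>0 < 1 \<and> (\<forall>m. 2 \<le> m \<and> eps_seq \<gamma> \<kappa> \<alpha> m < 1 \<longrightarrow> n\<^sub>0 \<le> m)) \<and>
    (\<forall>n \<ge> n\<^sub>0. \<forall>(M :: 'a measure) \<psi> w e y \<psi>_hat.
       mono_on U \<psi> \<and>
       (\<forall>u\<in>U. \<forall>v\<in>U. \<bar>\<psi> u - \<psi> v\<bar> \<le> C\<^sub>1 * \<bar>u - v\<bar> powr \<alpha>) \<and>
       regression_sample M n U C\<^sub>2 \<sigma> \<psi> w e y \<and>
       (\<forall>\<omega>\<in>space M. isotonic_lse n (\<lambda>t. w t \<omega>) (\<lambda>t. y t \<omega>) (\<psi>_hat \<omega>)) \<and>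
       (\<forall>u. (\<lambda>\<omega>. \<psi>_hat \<omega> u) \<in> borel_measurable M) \<longrightarrow>
       measure M {\<omega> \<in> space M.
           (SUP u \<in> inner_domain U (delta_seq \<kappa> \<alpha> n). ereal \<bar>\<psi>_hat \<omega> u - \<psi> u\<bar>)
             \<le> ereal (C * rho_seq n powr (\<alpha> / (2 * \<alpha> + 1)))}
         \<ge> 1 - 1 / real n powr (\<gamma> - 2))"
proof -

  \<comment> \<open>Constants of the bound\<close>
  obtain R where "0 < R" and "\<forall>u\<in>U. \<bar>u\<bar> \<le> R"
    using \<open>bounded U\<close> by (auto simp: bounded_pos)
  then have R: "U \<subseteq> {- R..R}"
    by (auto simp: abs_le_iff)
  \<comment> \<open>The \<open>+ 1\<close> keeps the proxy positive when
    \<open>\<sigma> = 0\<close>.\<close>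
  define v where "v = \<sigma>\<^sup>2 + 1"
  have v: "0 < v" "\<sigma>\<^sup>2 \<le> v"
    by (auto simp: v_def intro: add_nonneg_pos)
  \<comment> \<open>For \<open>n \<ge> 2\<close> this makes
    \<open>exp (- (z n)\<^sup>2 / (2 * v))\<close> equal to \<open>n powr - (\<gamma> + 2)\<close>,
    which absorbs the \<open>n\<^sup>2\<close> windows.\<close>
  define z where "z n = sqrt (2 * v * (\<gamma> + 2) * ln (real n))" for n :: nat
  \<comment> \<open>Bounds the oscillation of \<open>\<psi>\<close> on \<open>U\<close>, whose
    points are at most \<open>2 * R\<close> apart.\<close>
  define L where "L = C\<^sub>1 * (2 * R) powr \<alpha>"
  define a where "a = \<alpha> / (2 * \<alpha> + 1)"
  \<comment> \<open>Half the bandwidth, so that an interval of length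
    \<open>delta_seq \<kappa> \<alpha> n\<close> contains a full cell.\<close>
  define d where "d n = delta_seq \<kappa> \<alpha> n / 2" for n
  \<comment> \<open>Bias and noise constants. The noise term is \<open>z n / sqrt m\<close> with
    \<open>m = n * (C\<^sub>2 * d n) / 4\<close>; the 16 is the 2 in \<open>z n\<close> times the 8
    in \<open>d n / 4 = delta_seq \<kappa> \<alpha> n / 8\<close>.\<close>
  define C' where "C' = C\<^sub>1 * \<kappa> powr \<alpha> + sqrt (16 * v * (\<gamma> + 2) / (C\<^sub>2 * \<kappa>))"
  obtain N\<^sub>1 where N\<^sub>1: "\<And>n. N\<^sub>1 \<le> n \<Longrightarrow>
      (2 * R / d n + 1) * exp (- (real n * (C\<^sub>2 * d n) / 4)) \<le> real n powr (- \<gamma>)"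
    using eventually_cell_bound[OF \<open>0 < \<alpha>\<close> \<open>0 < \<kappa>\<close> \<open>0 < C\<^sub>2\<close> \<open>0 < R\<close>, of \<gamma>]
    by (auto simp: eventually_sequentially d_def)
  \<comment> \<open>The sum makes the crude bound \<open>L + z n\<close> sufficient for every \<open>n < N\<^sub>1\<close>.\<close>
  define C where "C = C' + (\<Sum>n\<in>{2..<N\<^sub>1}. (L + z n) / rho_seq n powr a)"
  have rho: "0 < rho_seq n" if "2 \<le> n" for n
    using that by (simp add: rho_seq_def)
  have z: "0 \<le> z n" for n
    using v \<open>2 < \<gamma>\<close> by (cases "n = 0") (auto simp: z_def)
  have "0 < C'"
    using assms v by (auto simp: C'_def intro!: add_pos_nonneg)
  have "0 \<le> L"
    using assms by (simp add: L_def)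
  have sum_nonneg: "0 \<le> (\<Sum>n\<in>{2..<N\<^sub>1}. (L + z n) / rho_seq n powr a)"
    using \<open>0 \<le> L\<close> z by (intro sum_nonneg) auto
  then have "0 < C" "C' \<le> C"
    using \<open>0 < C'\<close> by (auto simp: C_def)
  have crude_le: "L + z n \<le> C * rho_seq n powr a" if "2 \<le> n" "n < N\<^sub>1" for n
  proof -
    have "(L + z n) / rho_seq n powr a \<le> (\<Sum>n\<in>{2..<N\<^sub>1}. (L + z n) / rho_seq n powr a)"
      using that \<open>0 \<le> L\<close> z by (intro member_le_sum) auto
    also have "\<dots> \<le> C"
      using \<open>0 < C'\<close> by (simp add: C_def)
    finally show ?thesis
      using rho[OF that(1)] by (simp add: pos_divide_le_eq)
  qed
  have local_le: "C\<^sub>1 * delta_seq \<kappa> \<alpha> n powr \<alpha> + z n / sqrt (n * (C\<^sub>2 * d n) / 4) \<le> C * rho_seq n powr a"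
    if "2 \<le> n" for n
  proof -
    let ?\<rho> = "rho_seq n"
    have "delta_seq \<kappa> \<alpha> n powr \<alpha> = \<kappa> powr \<alpha> * ?\<rho> powr a"
      using rho[OF that] \<open>0 < \<kappa>\<close> by (simp add: delta_seq_def powr_mult powr_powr a_def)
    moreover have "z n / sqrt (n * (C\<^sub>2 * d n) / 4) =
        sqrt (16 * v * (\<gamma> + 2) / (C\<^sub>2 * \<kappa>) * (?\<rho> / ?\<rho> powr (1 / (2 * \<alpha> + 1))))"
      unfolding z_def d_def delta_seq_def real_sqrt_divide[symmetric] using that
      by (simp add: rho_seq_def field_simps)
    moreover have "\<dots> = sqrt (16 * v * (\<gamma> + 2) / (C\<^sub>2 * \<kappa>)) * ?\<rho> powr a"
      unfolding real_sqrt_mult a_def using powr_rate_exponent[of ?\<rho> \<alpha>] rho[OF that] \<open>0 < \<alpha>\<close> by simp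
    ultimately have "C\<^sub>1 * delta_seq \<kappa> \<alpha> n powr \<alpha> + z n / sqrt (n * (C\<^sub>2 * d n) / 4) = C' * ?\<rho> powr a"
      by (simp add: C'_def distrib_right)
    also have "\<dots> \<le> C * ?\<rho> powr a"
      using \<open>C' \<le> C\<close> by (intro mult_right_mono) auto
    finally show ?thesis .
  qed

  \<comment> \<open>Probability of the error bound for a given sample\<close>
  have bound: "measure M {\<omega> \<in> space M.
           (SUP u \<in> inner_domain U (delta_seq \<kappa> \<alpha> n). ereal \<bar>\<psi>_hat \<omega> u - \<psi> u\<bar>)
             \<le> ereal (C * rho_seq n powr (\<alpha> / (2 * \<alpha> + 1)))}
         \<ge> 1 - 1 / real n powr (\<gamma> - 2)"
    if "2 \<le> n" and \<psi>: "mono_on U \<psi>"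
      and holder: "\<forall>u\<in>U. \<forall>v\<in>U. \<bar>\<psi> u - \<psi> v\<bar> \<le> C\<^sub>1 * \<bar>u - v\<bar> powr \<alpha>"
      and sample: "regression_sample M n U C\<^sub>2 \<sigma> \<psi> w e y"
      and lse: "\<forall>\<omega>\<in>space M. isotonic_lse n (\<lambda>t. w t \<omega>) (\<lambda>t. y t \<omega>) (\<psi>_hat \<omega>)"
      and meas: "\<forall>u. (\<lambda>\<omega>. \<psi>_hat \<omega> u) \<in> borel_measurable M"
    for n and M :: "'a measure" and \<psi> w e y \<psi>_hat
  proof -
    interpret prob_space M
      using sample by (simp add: regression_sample_def)
    let ?\<delta> = "delta_seq \<kappa> \<alpha> n"
    have \<delta>: "0 < ?\<delta>"
      using rho[OF \<open>2 \<le> n\<close>] \<open>0 < \<kappa>\<close> by (simp add: delta_seq_def)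
    then have d: "0 < d n" "2 * d n = ?\<delta>"
      by (auto simp: d_def)
    obtain f where f: "\<And>t. t \<in> {1..n} \<Longrightarrow> distributed M lborel (w t) (\<lambda>u. ennreal (f u))"
        "\<And>u. u \<in> U \<Longrightarrow> C\<^sub>2 \<le> f u"
      using sample unfolding regression_sample_def by blast
    have indep: "indep_vars (\<lambda>_. borel) w {1..n}"
      using sample by (rule regression_sample_indep_design)
    have w: "w t \<in> borel_measurable M" if "t \<in> {1..n}" for t
      using indep that by (simp add: indep_vars_def)
    have wU: "(\<lambda>t. w t \<omega>) ` {1..n} \<subseteq> U"
      and y: "\<And>t. t \<in> {1..n} \<Longrightarrow> y t \<omega> = \<psi> (w t \<omega>) + e t \<omega>" if "\<omega> \<in> space M" for \<omega>
      using sample that unfolding regression_sample_def by auto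
    have e: "cond_indep_vars M (gen_algebra M {1..n} w) {1..n} e"
      "\<And>t. t \<in> {1..n} \<Longrightarrow> cond_subgaussian M (gen_algebra M {1..n} w) v (e t)"
      using sample v(2) unfolding regression_sample_def by (auto intro: cond_subgaussian_mono)
    \<comment> \<open>Pointwise form of the event on the supremum; for an empty inner domain both
      are the whole space.\<close>
    define E where "E = {\<omega> \<in> space M. \<forall>u \<in> inner_domain U ?\<delta>.
      \<bar>\<psi>_hat \<omega> u - \<psi> u\<bar> \<le> C * rho_seq n powr a}"
    have "E \<in> events"
      unfolding E_def
    proof (rule ball_abs_diff_measurable)
      show "is_interval (inner_domain U ?\<delta>)"
        using \<open>is_interval U\<close> \<delta> by (intro is_interval_inner_domain) auto
      have "continuous_on U \<psi>"
        using holder \<open>0 < \<alpha>\<close> by (intro holder_imp_continuous_on) auto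
      then show "continuous_on (inner_domain U ?\<delta>) \<psi>"
        by (rule continuous_on_subset) (auto simp: inner_domain_def)
      show "mono (\<psi>_hat \<omega>)" if "\<omega> \<in> space M" for \<omega>
        using lse that unfolding isotonic_lse_def is_arg_min_def by blast
    qed (use meas in blast)
    define N where "N = {\<omega> \<in> space M. \<exists>r\<in>{1..n}. \<exists>s\<in>{1..n}.
      z n * sqrt (card (window n (\<lambda>t. w t \<omega>) r s)) < \<bar>\<Sum>t\<in>window n (\<lambda>t. w t \<omega>) r s. e t \<omega>\<bar>}"
    have "N \<in> events" and N: "prob N \<le> 2 * (real n)\<^sup>2 * exp (- (z n)\<^sup>2 / (2 * v))"
      unfolding N_def by (rule window_noise_bound[OF w e v(1) z]; assumption)+
    have "(z n)\<^sup>2 / (2 * v) = (\<gamma> + 2) * ln n"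
      using v \<open>2 < \<gamma>\<close> \<open>2 \<le> n\<close> by (simp add: z_def)
    then have "exp (- (z n)\<^sup>2 / (2 * v)) = n powr - (\<gamma> + 2)"
      using \<open>2 \<le> n\<close> by (simp add: powr_def, simp add: algebra_simps)
    moreover have "(real n)\<^sup>2 * n powr - (\<gamma> + 2) = n powr - \<gamma>"
      using powr_add[of n 2 "- (\<gamma> + 2)"] by simp
    ultimately have probN: "prob N \<le> 2 * n powr - \<gamma>"
      using N by (simp only: mult.assoc)
    have noise: "\<bar>\<Sum>t\<in>window n (\<lambda>t. w t \<omega>) r s. e t \<omega>\<bar> \<le> z n * sqrt (card (window n (\<lambda>t. w t \<omega>) r s))"
      if "\<omega> \<in> space M - N" "r \<in> {1..n}" "s \<in> {1..n}" for \<omega> r s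
      using that unfolding N_def by (auto simp: not_less)
    \<comment> \<open>\<open>G\<close> is the bad event of the design: empty for
      \<open>n < N\<^sub>1\<close>, where the crude bound needs only the noise event, and otherwise
      an event covering all designs with a sparse interval.\<close>
    obtain G where G: "G \<in> events" "space M - (N \<union> G) \<subseteq> E" "prob G \<le> n powr - \<gamma>"
    proof (cases "n < N\<^sub>1")
      case True
      have "space M - (N \<union> {}) \<subseteq> E"
      proof
        fix \<omega> assume \<omega>: "\<omega> \<in> space M - (N \<union> {})"
        have osc: "\<bar>\<psi> u - \<psi> u'\<bar> \<le> L" if "u \<in> U" "u' \<in> U" for u u'
        proof -
          have "u \<in> {- R..R}" "u' \<in> {- R..R}"
            using that R by auto
          then have "\<bar>u - u'\<bar> \<le> 2 * R"
            by auto
          have "\<bar>\<psi> u - \<psi> u'\<bar> \<le> C\<^sub>1 * \<bar>u - u'\<bar> powr \<alpha>"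
            using holder that by blast
          also have "\<dots> \<le> L"
            unfolding L_def using \<open>\<bar>u - u'\<bar> \<le> 2 * R\<close> \<open>0 < C\<^sub>1\<close> \<open>0 < \<alpha>\<close>
            by (intro mult_left_mono powr_mono2) auto
          finally show ?thesis .
        qed
        have "\<bar>\<psi>_hat \<omega> u - \<psi> u\<bar> \<le> L + z n" if "u \<in> inner_domain U ?\<delta>" for u
        proof (rule isotonic_lse_crude_bound[OF _ _ y \<psi> wU noise z osc])
          show "isotonic_lse n (\<lambda>t. w t \<omega>) (\<lambda>t. y t \<omega>) (\<psi>_hat \<omega>)"
            using lse \<omega> by blast
          show "u \<in> U"
            using that by (simp add: inner_domain_def)
        qed (use \<omega> \<open>2 \<le> n\<close> in simp_all)
        then show "\<omega> \<in> E"
          using crude_le[OF \<open>2 \<le> n\<close> True] \<omega> unfolding E_def by force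
      qed
      then show ?thesis
        by (intro that[of "{}"]) auto
    next
      case False
      obtain G where G: "G \<in> events"
        "{\<omega> \<in> space M. \<exists>u. {u..u + 2 * d n} \<subseteq> U \<and>
          card {t \<in> {1..n}. u \<le> w t \<omega> \<and> w t \<omega> \<le> u + 2 * d n} < n * (C\<^sub>2 * d n) / 4} \<subseteq> G"
        "prob G \<le> (2 * R / d n + 1) * exp (- (n * (C\<^sub>2 * d n) / 4))"
        using design_density_bound[OF indep f less_imp_le[OF \<open>0 < C\<^sub>2\<close>] R d(1) \<open>0 < R\<close>] by blast
      have "space M - (N \<union> G) \<subseteq> E"
      proof
        fix \<omega> assume \<omega>: "\<omega> \<in> space M - (N \<union> G)"
        then have count: "n * (C\<^sub>2 * d n) / 4 \<le> card {t \<in> {1..n}. u \<le> w t \<omega> \<and> w t \<omega> \<le> u + ?\<delta>}"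
          if "{u..u + ?\<delta>} \<subseteq> U" for u
          using subsetD[OF G(2), of \<omega>] that \<omega> unfolding d(2) mem_Collect_eq by (meson DiffD1 DiffD2 UnI2 not_le_imp_less)
        have "\<bar>\<psi>_hat \<omega> u - \<psi> u\<bar> \<le> C\<^sub>1 * ?\<delta> powr \<alpha> + z n / sqrt (n * (C\<^sub>2 * d n) / 4)"
          if u: "u \<in> inner_domain U ?\<delta>" for u
        proof (rule lse_local_bound[OF _ y \<psi> wU noise])
          show "is_arg_min (\<lambda>h. \<Sum>t=1..n. (y t \<omega> - h (w t \<omega>))\<^sup>2) mono (\<psi>_hat \<omega>)"
            using lse \<omega> unfolding isotonic_lse_def by blast
          show "0 < n * (C\<^sub>2 * d n) / 4"
            using \<open>2 \<le> n\<close> \<open>0 < C\<^sub>2\<close> d by simp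
        qed (use u \<omega> \<delta> z holder count in auto)
        then show "\<omega> \<in> E"
          using local_le[OF \<open>2 \<le> n\<close>] \<omega> unfolding E_def by force
      qed
      then show ?thesis
        using G N\<^sub>1[of n] False by (intro that[of G]) auto
    qed
    have "1 - prob (N \<union> G) = prob (space M - (N \<union> G))"
      using \<open>N \<in> events\<close> G(1) by (simp add: prob_compl)
    also have "\<dots> \<le> prob E"
      using G(2) \<open>E \<in> events\<close> by (intro finite_measure_mono)
    finally have "1 - prob (N \<union> G) \<le> prob E" .
    moreover have "prob (N \<union> G) \<le> prob N + prob G"
      using \<open>N \<in> events\<close> G(1) by (rule measure_Un_le)
    \<comment> \<open>The 3 is 2 from \<open>N\<close> plus 1 from \<open>G\<close>. It is at most
      \<open>n\<^sup>2\<close>, which is where the exponent drops from \<open>\<gamma>\<close> to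
      \<open>\<gamma> - 2\<close>.\<close>
    moreover have "3 * n powr - \<gamma> \<le> 1 / n powr (\<gamma> - 2)"
    proof -
      have "2\<^sup>2 \<le> (real n)\<^sup>2"
        using \<open>2 \<le> n\<close> by (intro power_mono) auto
      then have "3 * n powr - \<gamma> \<le> (real n)\<^sup>2 * n powr - \<gamma>"
        by (intro mult_right_mono) auto
      also have "\<dots> = 1 / n powr (\<gamma> - 2)"
        using \<open>2 \<le> n\<close> by (simp add: powr_diff powr_minus field_simps)
      finally show ?thesis .
    qed
    ultimately have "1 - 1 / n powr (\<gamma> - 2) \<le> prob E"
      using probN G(3) by linarith
    then show ?thesis
      by (simp add: E_def SUP_le_iff a_def)
  qed
  \<comment> \<open>\<open>2 \<le> m\<close> excludes 0 and 1, where \<open>delta_seq\<close>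
    vanishes and division by zero would make \<open>eps_seq\<close> equal to 0.\<close>
  define P where "P m \<longleftrightarrow> 2 \<le> m \<and> eps_seq \<gamma> \<kappa> \<alpha> m < 1" for m
  have "\<forall>\<^sub>F m in sequentially. eps_seq \<gamma> \<kappa> \<alpha> m < 1"
    using eps_seq_tendsto_0[OF \<open>0 < \<alpha>\<close> \<open>0 < \<kappa>\<close>] by (rule order_tendstoD) simp
  then have "\<forall>\<^sub>F m in sequentially. P m"
    using eventually_ge_at_top[of 2] by eventually_elim (simp add: P_def)
  then obtain m where "P m"
    by (auto simp: eventually_sequentially)
  then obtain n\<^sub>0 where "P n\<^sub>0" and least: "\<And>m. P m \<Longrightarrow> n\<^sub>0 \<le> m"
    by (meson LeastI Least_le)
  show ?thesis
  proof (intro exI[of _ n\<^sub>0] exI[of _ C] conjI allI impI)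
    show "2 \<le> n\<^sub>0" "eps_seq \<gamma> \<kappa> \<alpha> n\<^sub>0 < 1"
      using \<open>P n\<^sub>0\<close> by (simp_all add: P_def)
  qed (use \<open>0 < C\<close> \<open>P n\<^sub>0\<close> least in \<open>auto simp: P_def intro!: bound\<close>)
qed

end
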